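(* Let $(g(n))_{n\ge 1}$ be a real-valued additive function such that, as $n\to\infty$, $$\Big(\sum_{q^\alpha\le n}\frac{g(q^\alpha)^2}{q^\alpha}\Big)^{1/2}=o\Big(\sum_{q^\alpha\le n}\frac{g(q^\alpha)}{q^\alpha}\Big),$$ where the sums run over all prime powers $q^\alpha\le n$ ($q$ prime, $\alpha\ge1$ an integer). Then, for every real $p>2$, $(g(n))_{n\ge 1}$ is a good weight for both the dominated ergodic theorem in $L^p$ and the pointwise ergodic theorem in $L^p$.
   Context: An arithmetic function $g$ is additive if $g(mn)=g(m)+g(n)$ whenever $m,n\ge1$ are coprime (so $g(1)=0$). A dynamical system $(X,\mathcal A,\nu,\tau)$ is a probability space $(X,\mathcal A,\nu)$ with a measurable transformation $\tau:X\to X$ preserving $\nu$. For a sequence of real numbers $(w_k)_{k\ge 1}$ put $W_n=\sum_{k=1}^n|w_k|$; it is assumed that $W_n\to\infty$, and the quotients below are taken to be $0$ for those (finitely many) $n$ with $W_n=0$. The sequence $(w_k)_{k\ge1}$ is a good weight for the dominated ergodic theorem in $L^p$, $p>1$, if there exists $C_p>0$ such that for every dynamical system $(X,\mathcal A,\nu,\tau)$ and every $f\in L^p(\nu)$, $$\Big\|\sup_{n\ge 1}\frac{|\sum_{1\le k\le n} w_k f\circ\tau^k|}{W_n}\Big\|_p\le C_p\|f\|_p .$$ It is a good weight for the pointwise ergodic theorem in $L^p$ if for every dynamical system $(X,\mathcal A,\nu,\tau)$ and every $f\in L^p(\nu)$ the sequence $\big(\frac1{W_n}\sum_{1\le k\le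 n} w_k f\circ\tau^k\big)_n$ converges $\nu$-a.s. *)

theory Defs
  imports
    "HOL-Probability.Probability"
    "HOL-Number_Theory.Prime_Powers"
    "HOL-Library.Landau_Symbols"
begin

text \<open>Arithmetic functions and weights are functions on \<^typ>\<open>nat\<close> whose value at 0 is never used.\<close>

definition additive_arith :: "(nat \<Rightarrow> real) \<Rightarrow> bool" where
  "additive_arith g \<longleftrightarrow> (\<forall>m\<ge>1. \<forall>n\<ge>1. coprime m n \<longrightarrow> g (m * n) = g m + g n)"

definition dynamical_system :: "'a measure \<Rightarrow> ('a \<Rightarrow> 'a) \<Rightarrow> bool" where
  "dynamical_system M \<tau> \<longleftrightarrow> prob_space M \<and> \<tau> \<in> M \<rightarrow>\<^sub>M M \<and> distr M M \<tau> = M"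

text \<open>Only used for exponents \<open>p > 0\<close>.\<close>

definition ennreal_powr :: "ennreal \<Rightarrow> real \<Rightarrow> ennreal" where
  "ennreal_powr x p = (if x = \<top> then \<top> else ennreal (enn2real x powr p))"

definition Lp_norm :: "'a measure \<Rightarrow> real \<Rightarrow> ('a \<Rightarrow> ennreal) \<Rightarrow> ennreal" where
  "Lp_norm M p h = ennreal_powr (\<integral>\<^sup>+ x. ennreal_powr (h x) p \<partial>M) (1 / p)"

definition Lp :: "'a measure \<Rightarrow> real \<Rightarrow> ('a \<Rightarrow> complex) set" where
  "Lp M p = {f \<in> borel_measurable M. Lp_norm M p (\<lambda>x. ennreal (norm (f x))) < \<top>}"

definition weight_sum :: "(nat \<Rightarrow> real) \<Rightarrow> nat \<Rightarrow> real" where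
  "weight_sum w n = (\<Sum>k=1..n. \<bar>w k\<bar>)"

definition admissible_weight :: "(nat \<Rightarrow> real) \<Rightarrow> bool" where
  "admissible_weight w \<longleftrightarrow> filterlim (weight_sum w) at_top sequentially"

text \<open>Where \<open>weight_sum w n = 0\<close> the average is 0, since \<open>inverse 0 = 0\<close>.\<close>

definition weighted_average ::
  "(nat \<Rightarrow> real) \<Rightarrow> ('a \<Rightarrow> 'a) \<Rightarrow> ('a \<Rightarrow> complex) \<Rightarrow> nat \<Rightarrow> 'a \<Rightarrow> complex" where
  "weighted_average w \<tau> f n x =
     (\<Sum>k=1..n. w k *\<^sub>R f ((\<tau> ^^ k) x)) /\<^sub>R weight_sum w n"

definition dominated_bound :: "'a itself \<Rightarrow> (nat \<Rightarrow> real) \<Rightarrow> real \<Rightarrow> real \<Rightarrow> bool" where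
  "dominated_bound (T :: 'a itself) w p C \<longleftrightarrow>
     (\<forall>(M :: 'a measure) \<tau>. dynamical_system M \<tau> \<longrightarrow> (\<forall>f \<in> Lp M p.
        Lp_norm M p (\<lambda>x. SUP n\<in>{1..}. ennreal (norm (weighted_average w \<tau> f n x)))
          \<le> ennreal C * Lp_norm M p (\<lambda>x. ennreal (norm (f x)))))"

text \<open>
  The constant must serve all dynamical systems at once, but a formula cannot quantify over the
  type of the underlying space, and with \<open>\<exists>C>0. dominated_bound TYPE('a) w p C\<close> the constant
  might depend on \<open>'a\<close>. Hence a constant is required to exist for the systems living on one
  fixed type, the type of complex sequences, and every such constant is required to work on
  \<open>'a\<close> as well. If this holds for every type \<open>'a\<close>, then there is one constant, depending only
  on \<open>w\<close> and \<open>p\<close>, that works on all types. Conversely, the second conjunct costs nothing: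
  \<open>(M, \<tau>, f)\<close> may be replaced by the law of the sequence \<open>k \<mapsto> f (\<tau> ^^ k)\<close> under \<open>M\<close>, with the
  shift and the zeroth coordinate, which leaves both norms unchanged.
\<close>

definition good_weight_dominated :: "'a itself \<Rightarrow> (nat \<Rightarrow> real) \<Rightarrow> real \<Rightarrow> bool" where
  "good_weight_dominated (T :: 'a itself) w p \<longleftrightarrow>
     admissible_weight w \<and>
     (\<exists>C>0. dominated_bound TYPE(nat \<Rightarrow> complex) w p C) \<and>
     (\<forall>C>0. dominated_bound TYPE(nat \<Rightarrow> complex) w p C \<longrightarrow> dominated_bound TYPE('a) w p C)"

definition good_weight_pointwise :: "'a itself \<Rightarrow> (nat \<Rightarrow> real) \<Rightarrow> real \<Rightarrow> bool" where
  "good_weight_pointwise (T :: 'a itself) w p \<longleftrightarrow>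
     admissible_weight w \<and>
     (\<forall>(M :: 'a measure) \<tau>. dynamical_system M \<tau> \<longrightarrow> (\<forall>f \<in> Lp M p.
        AE x in M. convergent (\<lambda>n. weighted_average w \<tau> f n x)))"

end

theory Submission
  imports Defs
begin

text \<open>
  Write \<open>A n = (\<Sum>Q\<le>n. g Q / Q)\<close> and \<open>V n = (\<Sum>Q\<le>n. (g Q)\<^sup>2 / Q)\<close>, both sums over prime powers, and
  \<open>W n = (\<Sum>k\<le>n. \<bar>g k\<bar>)\<close>. The Turan-Kubilius inequality \<open>Turan_Kubilius\<close> says that
  \<open>(\<Sum>k\<le>n. (g k - A n)\<^sup>2) \<le> 54 n V n\<close> for every additive \<open>g\<close>. The hypothesis is \<open>V n = o((A n)\<^sup>2)\<close>, so in
  quadratic mean over \<open>{1..n}\<close> the weight \<open>g\<close> is the constant \<open>A n\<close> up to a relative error \<open>o(1)\<close>.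
  Hence \<open>W n\<close> is asymptotic to \<open>n \<bar>A n\<bar>\<close>, and \<open>(\<Sum>k\<le>n. (g k)\<^sup>2)\<close> is at most a constant times
  \<open>(W n)\<^sup>2 / n\<close>. Moreover \<open>A n\<close> has a constant sign for large \<open>n\<close>, since a single increment of \<open>A\<close> is at
  most \<open>sqrt (V n)\<close>; so \<open>n A n / W n\<close> converges. This is \<open>additive_concentrated\<close>.

  By Cauchy-Schwarz, a weight sum over an orbit is at most the \<open>l\<^sup>2\<close> norm of the weights times
  \<open>sqrt (\<Sum>k\<le>n. \<bar>f (\<tau>\<^sup>k x)\<bar>\<^sup>2)\<close>. Applied to the weights \<open>g k\<close>, it bounds all weighted averages at \<open>x\<close>
  by a constant times the square root of the maximal function of \<open>\<bar>f\<bar>\<^sup>2\<close>. For \<open>p > 2\<close> the function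
  \<open>\<bar>f\<bar>\<^sup>2\<close> lies in \<open>L\<^sup>r\<close> with \<open>r = p / 2 > 1\<close>, where the maximal operator is bounded
  (\<open>dominated_ergodic\<close>); this is the dominated theorem. Applied to the weights \<open>g k - A n\<close>, it shows
  that the weighted average differs from \<open>n A n / W n\<close> times the plain average of \<open>f\<close> by \<open>o(1)\<close> times
  the square root of the plain average of \<open>\<bar>f\<bar>\<^sup>2\<close>; Birkhoff's theorem for \<open>f\<close> and for \<open>\<bar>f\<bar>\<^sup>2\<close> then gives
  the pointwise theorem.

  The Turan-Kubilius inequality is proved by cutting the prime powers at \<open>sqrt n\<close>. Below the cut, exact
  divisibility by powers of two different primes is uncorrelated up to a bounded counting error, and
  there are at most \<open>n\<close> pairs. At most one prime power above the cut divides
  a given \<open>k \<le> n\<close> exactly, so there the square of the sum is the sum of the squares. Counting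
  the same events also yields \<open>(\<Sum>1 / Q) \<le> 4\<close> over the prime powers in
  \<open>(sqrt n, n]\<close>, so that \<open>A n\<close> differs from the sum up to the cut by only \<open>O(sqrt (V n))\<close>.

  Both ergodic theorems come from the maximal ergodic theorem \<open>maximal_ergodic\<close>. A constant valid for
  all systems at once is obtained because the constants depend only on the weight and on \<open>p\<close>, and any
  constant valid on the sequence space is valid everywhere by passing to the law of the orbit
  (\<open>dominated_bound_transfer\<close>).
\<close>

section \<open>Exact divisibility by prime powers\<close>

abbreviation primepows_upto :: "nat \<Rightarrow> nat set" where
  "primepows_upto n \<equiv> {m. primepow m \<and> m \<le> n}"

text \<open>
  The indicator of exact divisibility is written as a difference of indicators of plain
  divisibility: these multiply for coprime divisors and sum to an integer quotient, so every count
  below is a signed sum of integer quotients.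
\<close>

definition divind :: "nat \<Rightarrow> nat \<Rightarrow> real" where
  "divind d k = of_bool (d dvd k)"

definition exactly :: "nat \<Rightarrow> nat \<Rightarrow> real" where
  "exactly Q k = divind Q k - divind (aprimedivisor Q * Q) k"

text \<open>
  The limiting frequency of the integers that \<open>Q\<close> divides exactly.
\<close>

definition exact_density :: "nat \<Rightarrow> real" where
  "exact_density Q = 1 / real Q - 1 / real (aprimedivisor Q * Q)"

lemma finite_primepows_upto [simp]: "finite (primepows_upto n)"
  by (rule finite_subset[of _ "{..n}"]) auto

lemma primepow_aprimedivisorE:
  assumes "primepow (Q::nat)"
  obtains a where "prime (aprimedivisor Q)" "a \<ge> 1" "Q = aprimedivisor Q ^ a"
proof -
  from assms obtain p a where "prime p" "a > 0" "Q = p ^ a"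
    unfolding primepow_def by blast
  thus ?thesis using that[of a] by (simp add: aprimedivisor_prime_power)
qed

lemma exactly_eq_of_bool: "exactly Q k = of_bool (Q dvd k \<and> \<not> aprimedivisor Q * Q dvd k)"
  by (auto simp: exactly_def divind_def dest: dvd_mult_right)

lemma exactly_iff_multiplicity:
  assumes "prime p" "a \<ge> 1" "k \<ge> 1"
  shows "exactly (p ^ a) k = of_bool (multiplicity p k = a)"
proof -
  have "aprimedivisor (p ^ a) = p" using assms by (simp add: aprimedivisor_prime_power)
  moreover have "p ^ b dvd k \<longleftrightarrow> b \<le> multiplicity p k" for b
    using assms by (intro power_dvd_iff_le_multiplicity) auto
  from this[of a] this[of "Suc a"] have "p ^ a dvd k \<and> \<not> p * p ^ a dvd k \<longleftrightarrow> multiplicity p k = a"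
    by auto
  ultimately show ?thesis by (simp add: exactly_eq_of_bool)
qed

lemma exactly_same_prime:
  assumes "primepow Q" "primepow R" "aprimedivisor Q = aprimedivisor R" "k \<ge> 1" "Q \<noteq> R"
  shows "exactly Q k * exactly R k = 0"
proof -
  obtain a where a: "prime (aprimedivisor Q)" "a \<ge> 1" "Q = aprimedivisor Q ^ a"
    using primepow_aprimedivisorE[OF assms(1)] .
  obtain b where b: "b \<ge> 1" "R = aprimedivisor Q ^ b"
    using primepow_aprimedivisorE[OF assms(2)] assms(3) by metis
  have "exactly Q k = of_bool (multiplicity (aprimedivisor Q) k = a)"
    using exactly_iff_multiplicity[OF a(1,2) assms(4)] a(3) by simp
  moreover have "exactly R k = of_bool (multiplicity (aprimedivisor Q) k = b)"
    using exactly_iff_multiplicity[OF a(1) b(1) assms(4)] b(2) by simp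
  moreover have "a \<noteq> b" using a b assms(5) by metis
  ultimately show ?thesis by simp
qed

text \<open>
  The exponents \<open>i, j \<in> {0, 1}\<close> cover the four pairs of divisors that occur in the product of two
  indicators of exact divisibility.
\<close>

lemma coprime_primepow:
  assumes "primepow Q" "primepow R" "aprimedivisor Q \<noteq> aprimedivisor (R::nat)"
  shows "coprime (aprimedivisor Q ^ i * Q) (aprimedivisor R ^ j * R)"
proof -
  obtain a where a: "prime (aprimedivisor Q)" "Q = aprimedivisor Q ^ a"
    using primepow_aprimedivisorE[OF assms(1)] .
  obtain b where b: "prime (aprimedivisor R)" "R = aprimedivisor R ^ b"
    using primepow_aprimedivisorE[OF assms(2)] .
  have "coprime (aprimedivisor Q) (aprimedivisor R)"
    using a b assms(3) by (simp add: primes_coprime)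
  hence "coprime (aprimedivisor Q ^ (i + a)) (aprimedivisor R ^ (j + b))"
    by simp
  thus ?thesis using a b by (metis power_add)
qed

lemma additive_arith_1: "additive_arith g \<Longrightarrow> g 1 = 0"
  unfolding additive_arith_def by (metis add_cancel_right_right coprime_1_left le_refl mult_1)

text \<open>
  An additive function is determined by its values on prime powers: for the factorization of \<open>k\<close>,
  the prime powers dividing \<open>k\<close> exactly are the factors \<open>p ^ multiplicity p k\<close>.
  So \<open>g\<close> is a linear combination of the indicators of exact divisibility.
\<close>

lemma additive_arith_eq_sum:
  assumes g: "additive_arith g" and k: "1 \<le> k" "k \<le> n"
  shows "g k = (\<Sum>Q\<in>primepows_upto n. g Q * exactly Q k)"
proof -
  have prod: "g (\<Prod>p\<in>P. p ^ e p) = (\<Sum>p\<in>P. g (p ^ e p))"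
    if "finite P" "\<And>p. p \<in> P \<Longrightarrow> prime p" for P :: "nat set" and e
    using that
  proof (induction P rule: finite_induct)
    case empty
    show ?case using additive_arith_1[OF g] by simp
  next
    case (insert q P)
    have pos: "q ^ e q \<ge> 1" "(\<Prod>p\<in>P. p ^ e p) \<ge> 1"
      using insert.prems by (auto simp: Suc_le_eq prime_gt_0_nat intro!: prod_pos)
    have "coprime (q ^ e q) (\<Prod>p\<in>P. p ^ e p)"
      using insert by (intro prod_coprime_right) (metis coprime_power_left_iff coprime_power_right_iff insertCI primes_coprime)
    hence "g (q ^ e q * (\<Prod>p\<in>P. p ^ e p)) = g (q ^ e q) + g (\<Prod>p\<in>P. p ^ e p)"
      using g pos unfolding additive_arith_def by blast
    thus ?case using insert by simp
  qed
  have "g k = g (\<Prod>p\<in>prime_factors k. p ^ multiplicity p k)"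
    using k prime_factorization_nat[of k] by simp
  also have "\<dots> = (\<Sum>p\<in>prime_factors k. g (p ^ multiplicity p k))"
    by (intro prod) auto
  also have "\<dots> = (\<Sum>Q | primepow Q \<and> Q \<le> n \<and> exactly Q k \<noteq> 0. g Q * exactly Q k)"
  proof (rule sum.reindex_bij_witness[where j = "\<lambda>p. p ^ multiplicity p k" and i = aprimedivisor])
    fix p assume p: "p \<in> prime_factors k"
    hence pr: "prime p" "multiplicity p k \<ge> 1"
      using prime_factors_multiplicity[of k] by auto
    thus "aprimedivisor (p ^ multiplicity p k) = p" by (simp add: aprimedivisor_prime_power)
    have ex: "exactly (p ^ multiplicity p k) k = 1"
      using exactly_iff_multiplicity[OF pr k(1)] by simp
    have "p ^ multiplicity p k \<le> k" using k by (intro dvd_imp_le multiplicity_dvd) auto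
    thus "p ^ multiplicity p k \<in> {Q. primepow Q \<and> Q \<le> n \<and> exactly Q k \<noteq> 0}"
      using pr k ex by auto
    show "g (p ^ multiplicity p k) * exactly (p ^ multiplicity p k) k = g (p ^ multiplicity p k)"
      using ex by simp
  next
    fix Q assume Q: "Q \<in> {Q. primepow Q \<and> Q \<le> n \<and> exactly Q k \<noteq> 0}"
    then obtain a where a: "prime (aprimedivisor Q)" "a \<ge> 1" "Q = aprimedivisor Q ^ a"
      using primepow_aprimedivisorE by blast
    have m: "multiplicity (aprimedivisor Q) k = a"
      using Q exactly_iff_multiplicity[OF a(1,2) k(1)] a(3) by (auto split: if_splits)
    thus "aprimedivisor Q ^ multiplicity (aprimedivisor Q) k = Q" using a by simp
    show "aprimedivisor Q \<in> prime_factors k"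
      using a m by (subst prime_factors_multiplicity) auto
  qed
  also have "\<dots> = (\<Sum>Q\<in>primepows_upto n. g Q * exactly Q k)"
    by (intro sum.mono_neutral_left) auto
  finally show ?thesis .
qed

lemma sum_divind: "(\<Sum>k=1..n. divind d k) = real (n div d)"
proof (induction n)
  case (Suc n)
  have "Suc n div d = n div d + of_bool (d dvd Suc n)"
    by (auto simp: div_Suc mod_eq_0_iff_dvd)
  thus ?case using Suc by (simp add: divind_def)
qed auto

lemma divind_mult: "coprime a b \<Longrightarrow> divind a k * divind b k = divind (a * b) k"
  by (auto simp: divind_def divides_mult dest: dvd_mult_left dvd_mult_right)

lemma real_div_bounds: "d > 0 \<Longrightarrow> real (n div d) \<le> real n / real d \<and> real n / real d - 1 \<le> real (n div d)"
proof -
  assume d: "d > 0"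
  have "real n = real d * real (n div d) + real (n mod d)"
    by (metis mult_div_mod_eq of_nat_add of_nat_mult)
  moreover have "n mod d < d" using d by simp
  ultimately show ?thesis using d by (simp add: field_simps of_nat_diff)
qed

lemma sum_exactly: "(\<Sum>k=1..n. exactly Q k) = real (n div Q) - real (n div (aprimedivisor Q * Q))"
  by (simp add: exactly_def sum_subtractf sum_divind del: One_nat_def)

lemma primepow_and_base_ge_2:
  assumes "primepow (Q::nat)"
  shows "Q \<ge> 2" "prime (aprimedivisor Q)" "aprimedivisor Q \<ge> 2"
  using assms primepow_gt_Suc_0[of Q] primepow_aprimedivisorE[OF assms] prime_ge_2_nat
  by (auto simp: Suc_le_eq numeral_2_eq_2)

lemma exact_density_bounds:
  assumes "primepow Q"
  shows "0 \<le> exact_density Q" "exact_density Q \<le> 1 / real Q"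
  using primepow_and_base_ge_2[OF assms] by (auto simp: exact_density_def field_simps)

lemma exactly_bounds: "0 \<le> exactly Q k" "exactly Q k \<le> 1"
  by (auto simp: exactly_eq_of_bool)

lemma sum_exactly_approx:
  assumes "primepow Q"
  shows "\<bar>(\<Sum>k=1..n. exactly Q k) - real n * exact_density Q\<bar> \<le> 1"
proof -
  have "Q > 0" "aprimedivisor Q * Q > 0" using primepow_and_base_ge_2[OF assms] by auto
  from real_div_bounds[OF this(1), of n] real_div_bounds[OF this(2), of n] show ?thesis
    unfolding sum_exactly exact_density_def right_diff_distrib times_divide_eq_right mult_1_right
    by linarith
qed

lemma sum_exactly_le:
  assumes "primepow Q"
  shows "(\<Sum>k=1..n. exactly Q k) \<le> real n / real Q"
proof -
  have "Q > 0" using primepow_and_base_ge_2[OF assms] by auto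
  from real_div_bounds[OF this, of n] show ?thesis
    unfolding sum_exactly by linarith
qed

text \<open>
  The quotient \<open>n div Q\<close> is at least half of \<open>n / Q\<close> once \<open>Q \<le> n\<close>, and at most half of these multiples
  are divisible by a further factor \<open>aprimedivisor Q\<close>. A lower bound of the right order is what
  allows sums of \<open>1 / Q\<close> to be bounded by counting.
\<close>

lemma sum_exactly_ge:
  assumes "primepow Q" "Q \<le> n"
  shows "real n / (4 * real Q) \<le> (\<Sum>k=1..n. exactly Q k)"
proof -
  have f: "Q \<ge> 2" "aprimedivisor Q \<ge> 2" using primepow_and_base_ge_2[OF assms(1)] by auto
  have "n div (aprimedivisor Q * Q) = (n div Q) div aprimedivisor Q"
    by (simp add: div_mult2_eq mult.commute)
  also have "\<dots> \<le> (n div Q) div 2" using f by (intro div_le_mono2) auto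
  finally have 1: "2 * (n div (aprimedivisor Q * Q)) \<le> n div Q" by linarith
  have 2: "n div Q \<ge> 1" using assms f by (simp add: Suc_le_eq div_greater_zero_iff)
  have "real n / real Q - 1 \<le> real (n div Q)" using real_div_bounds[of Q n] f by auto
  hence "real n / real Q \<le> 2 * real (n div Q)" using 2 by linarith
  moreover have "2 * real (n div (aprimedivisor Q * Q)) \<le> real (n div Q)" using 1 by linarith
  moreover have "real n / (4 * real Q) = (real n / real Q) / 4" by simp
  ultimately show ?thesis unfolding sum_exactly by linarith
qed

text \<open>
  For powers of different primes the count is a signed sum of four integer quotients, two with each
  sign, so the rounding errors amount to at most 2.
\<close>

lemma sum_exactly_mult_approx:
  assumes "primepow Q" "primepow R" "aprimedivisor Q \<noteq> aprimedivisor R"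
  shows "\<bar>(\<Sum>k=1..n. exactly Q k * exactly R k) - real n * exact_density Q * exact_density R\<bar> \<le> 2"
proof -
  let ?q = "aprimedivisor Q" and ?r = "aprimedivisor R"
  have cop: "coprime Q R" "coprime Q (?r * R)" "coprime (?q * Q) R" "coprime (?q * Q) (?r * R)"
    using coprime_primepow[OF assms, of 0 0] coprime_primepow[OF assms, of 0 1]
      coprime_primepow[OF assms, of 1 0] coprime_primepow[OF assms, of 1 1] by simp_all
  have pos: "Q > 0" "R > 0" "?q > 0" "?r > 0" using primepow_and_base_ge_2[OF assms(1)] primepow_and_base_ge_2[OF assms(2)] by auto
  have "exactly Q k * exactly R k = divind (Q * R) k - divind (Q * (?r * R)) k
      - divind (?q * Q * R) k + divind (?q * Q * (?r * R)) k" for k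
    unfolding exactly_def divind_mult[OF cop(1), symmetric] divind_mult[OF cop(2), symmetric]
      divind_mult[OF cop(3), symmetric] divind_mult[OF cop(4), symmetric] by (simp add: algebra_simps)
  hence eq: "(\<Sum>k=1..n. exactly Q k * exactly R k) = real (n div (Q * R)) - real (n div (Q * (?r * R)))
      - real (n div (?q * Q * R)) + real (n div (?q * Q * (?r * R)))"
    by (simp add: sum.distrib sum_subtractf sum_divind del: One_nat_def)
  have eq2: "real n * exact_density Q * exact_density R =
      real n / real (Q * R) - real n / real (Q * (?r * R)) - real n / real (?q * Q * R) + real n / real (?q * Q * (?r * R))"
    using pos by (simp add: exact_density_def field_simps)
  have "Q * R > 0" "Q * (?r * R) > 0" "?q * Q * R > 0" "?q * Q * (?r * R) > 0"
    using pos by simp_all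
  from this[THEN real_div_bounds, of n] show ?thesis
    unfolding eq eq2 by linarith
qed

text \<open>
  The covariance, not divided by \<open>n\<close>, of two exact divisibility events under the uniform
  distribution on \<open>{1..n}\<close>, centred at the limiting densities.
\<close>

definition exact_cov :: "nat \<Rightarrow> nat \<Rightarrow> nat \<Rightarrow> real" where
  "exact_cov n Q R = (\<Sum>k=1..n. (exactly Q k - exact_density Q) * (exactly R k - exact_density R))"

lemma exact_cov_eq: "exact_cov n Q R = (\<Sum>k=1..n. exactly Q k * exactly R k)
   - exact_density R * (\<Sum>k=1..n. exactly Q k) - exact_density Q * (\<Sum>k=1..n. exactly R k)
   + real n * exact_density Q * exact_density R"
proof -
  have "exact_cov n Q R = (\<Sum>k=1..n. exactly Q k * exactly R k - exact_density R * exactly Q k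
     - exact_density Q * exactly R k + exact_density Q * exact_density R)"
    unfolding exact_cov_def by (intro sum.cong) (auto simp: algebra_simps)
  thus ?thesis by (simp add: sum.distrib sum_subtractf sum_distrib_left)
qed

lemma exact_cov_coprime:
  assumes "primepow Q" "primepow R" "aprimedivisor Q \<noteq> aprimedivisor R"
  shows "\<bar>exact_cov n Q R\<bar> \<le> 4"
proof -
  let ?w = exact_density and ?s = "\<lambda>Q. \<Sum>k=1..n. exactly Q k"
  have le1: "\<bar>?w Q * (?s R - real n * ?w R)\<bar> \<le> 1" if "primepow Q" "primepow R" for Q R
  proof -
    have "1 / real Q \<le> 1" using primepow_and_base_ge_2[OF that(1)] by simp
    hence "\<bar>?w Q\<bar> \<le> 1" using exact_density_bounds[OF that(1)] by linarith
    thus ?thesis using sum_exactly_approx[OF that(2), of n] by (simp add: abs_mult mult_le_one)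
  qed
  have "exact_cov n Q R = ((\<Sum>k=1..n. exactly Q k * exactly R k) - real n * ?w Q * ?w R)
      - ?w R * (?s Q - real n * ?w Q) - ?w Q * (?s R - real n * ?w R)"
    unfolding exact_cov_eq by (simp add: algebra_simps)
  thus ?thesis using sum_exactly_mult_approx[OF assms, of n] le1[OF assms(1,2)] le1[OF assms(2,1)]
    by linarith
qed

text \<open>
  Different powers of one prime never both divide \<open>k\<close> exactly, so they are not independent at all;
  but then each of the three remaining terms is at most \<open>n / (Q R)\<close>, which is summable over powers of one prime.
\<close>

lemma exact_cov_same_prime:
  assumes "primepow Q" "primepow R" "aprimedivisor Q = aprimedivisor R"
  shows "\<bar>exact_cov n Q R\<bar> \<le> of_bool (Q = R) * (real n / real Q) + 3 * (real n / (real Q * real R))"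
proof -
  let ?w = exact_density and ?s = "\<lambda>Q. \<Sum>k=1..n. exactly Q k"
  have pos: "Q > 0" "R > 0" using primepow_and_base_ge_2[OF assms(1)] primepow_and_base_ge_2[OF assms(2)] by auto
  have a: "0 \<le> ?w Q * ?s R \<and> ?w Q * ?s R \<le> real n / (real Q * real R)" if "primepow Q" "primepow R" for Q R
  proof -
    have "?s R \<ge> 0" by (intro sum_nonneg exactly_bounds)
    moreover have "?w Q * ?s R \<le> (1 / real Q) * (real n / real R)"
      using exact_density_bounds[OF that(1)] sum_exactly_le[OF that(2), of n] \<open>?s R \<ge> 0\<close>
      by (intro mult_mono) auto
    ultimately show ?thesis using exact_density_bounds[OF that(1)] by simp
  qed
  have b: "0 \<le> real n * ?w Q * ?w R \<and> real n * ?w Q * ?w R \<le> real n / (real Q * real R)"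
  proof -
    have "?w Q * ?w R \<le> (1 / real Q) * (1 / real R)"
      using exact_density_bounds[OF assms(1)] exact_density_bounds[OF assms(2)] by (intro mult_mono) auto
    hence "real n * (?w Q * ?w R) \<le> real n * ((1 / real Q) * (1 / real R))"
      by (intro mult_left_mono) auto
    thus ?thesis using exact_density_bounds[OF assms(1)] exact_density_bounds[OF assms(2)]
      by (simp add: mult.assoc)
  qed
  have c: "0 \<le> (\<Sum>k=1..n. exactly Q k * exactly R k) \<and>
     (\<Sum>k=1..n. exactly Q k * exactly R k) \<le> of_bool (Q = R) * (real n / real Q)"
  proof (cases "Q = R")
    case True
    have "exactly Q k * exactly R k = exactly Q k" for k by (simp add: True exactly_eq_of_bool)
    hence "(\<Sum>k=1..n. exactly Q k * exactly R k) = (\<Sum>k=1..n. exactly Q k)" by (rule sum.cong[OF refl])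
    moreover have "(\<Sum>k=1..n. exactly Q k) \<ge> 0" by (intro sum_nonneg exactly_bounds)
    ultimately show ?thesis using True sum_exactly_le[OF assms(1), of n] by simp
  next
    case False
    hence "(\<Sum>k=1..n. exactly Q k * exactly R k) = 0"
      using exactly_same_prime[OF assms] by (intro sum.neutral) auto
    thus ?thesis using False by simp
  qed
  show ?thesis unfolding exact_cov_eq
    using a[OF assms(1,2)] a[OF assms(2,1), unfolded mult.commute[of "real R" "real Q"]] b c by linarith
qed

lemma sum_inverse_same_prime:
  assumes q: "prime q"
  shows "(\<Sum>R | primepow R \<and> R \<le> n \<and> aprimedivisor R = q. 1 / real R) \<le> 1"
proof -
  have q2: "real q \<ge> 2" using prime_ge_2_nat[OF q] by simp
  have sub: "{R. primepow R \<and> R \<le> n \<and> aprimedivisor R = q} \<subseteq> (\<lambda>b. q ^ Suc b) ` {..n}"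
  proof safe
    fix R assume R: "primepow R" "R \<le> n" "q = aprimedivisor R"
    obtain b where b: "prime (aprimedivisor R)" "b \<ge> 1" "R = aprimedivisor R ^ b"
      using primepow_aprimedivisorE[OF R(1)] .
    have "b \<le> R" using b by (metis less_exp less_imp_le order_trans power_mono prime_ge_2_nat zero_le)
    thus "R \<in> (\<lambda>ba. aprimedivisor R ^ Suc ba) ` {..n}" using b R
      by (intro image_eqI[of _ _ "b - 1"]) auto
  qed
  have "(\<Sum>R | primepow R \<and> R \<le> n \<and> aprimedivisor R = q. 1 / real R)
      \<le> (\<Sum>R\<in>(\<lambda>b. q ^ Suc b) ` {..n}. 1 / real R)"
    using sub by (intro sum_mono2) auto
  also have "\<dots> \<le> (\<Sum>b\<le>n. 1 / real (q ^ Suc b))"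
    using sum_image_le[of "{..n}" "\<lambda>R. 1 / real R" "\<lambda>b. q ^ Suc b"] unfolding o_def by simp
  also have "\<dots> \<le> (\<Sum>b\<le>n. (1 / 2) ^ Suc b)"
  proof (intro sum_mono)
    fix b
    have "(1 / real q) ^ Suc b \<le> (1 / 2) ^ Suc b"
      using q2 by (intro power_mono) (auto simp: field_simps)
    thus "1 / real (q ^ Suc b) \<le> (1 / 2) ^ Suc b" by (simp add: power_one_over)
  qed
  also have "\<dots> \<le> 1"
  proof -
    have "(\<Sum>b\<le>n. (1 / 2 :: real) ^ Suc b) = 1 - (1/2) ^ Suc n" by (induction n) auto
    thus ?thesis by simp
  qed
  finally show ?thesis .
qed


section \<open>The Turan-Kubilius inequality\<close>

lemma weighted_Cauchy_Schwarz:
  fixes g u :: "nat \<Rightarrow> real"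
  assumes "\<And>Q. Q \<in> S \<Longrightarrow> Q > 0"
  shows "(\<Sum>Q\<in>S. \<bar>g Q\<bar> * u Q)\<^sup>2 \<le> (\<Sum>Q\<in>S. (g Q)\<^sup>2 / real Q) * (\<Sum>Q\<in>S. real Q * (u Q)\<^sup>2)"
proof -
  have "(\<Sum>Q\<in>S. \<bar>g Q\<bar> * u Q) = (\<Sum>Q\<in>S. (\<bar>g Q\<bar> / sqrt (real Q)) * (sqrt (real Q) * u Q))"
    using assms by (intro sum.cong) auto
  moreover have "(\<Sum>Q\<in>S. (g Q)\<^sup>2 / real Q) = (\<Sum>Q\<in>S. (\<bar>g Q\<bar> / sqrt (real Q))\<^sup>2)"
    by (simp add: power_divide)
  moreover have "(\<Sum>Q\<in>S. real Q * (u Q)\<^sup>2) = (\<Sum>Q\<in>S. (sqrt (real Q) * u Q)\<^sup>2)"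
    by (simp add: power_mult_distrib)
  ultimately show ?thesis using Cauchy_Schwarz_ineq_sum by metis
qed

definition pp_mean :: "(nat \<Rightarrow> real) \<Rightarrow> nat \<Rightarrow> real" where
  "pp_mean g n = (\<Sum>m | primepow m \<and> m \<le> n. g m / real m)"

text \<open>
  An upper bound for the variance of the part of \<open>g\<close> carried by prime powers up to \<open>n\<close>, in the model
  where the multiplicities of different primes are independent with the limiting densities.
\<close>

definition pp_var :: "(nat \<Rightarrow> real) \<Rightarrow> nat \<Rightarrow> real" where
  "pp_var g n = (\<Sum>m | primepow m \<and> m \<le> n. (g m)\<^sup>2 / real m)"

lemma pp_var_nonneg: "0 \<le> pp_var g n"
  unfolding pp_var_def by (intro sum_nonneg) auto

lemma pp_var_mono: "m \<le> n \<Longrightarrow> pp_var g m \<le> pp_var g n"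
  unfolding pp_var_def by (intro sum_mono2) auto

text \<open>
  Expanding the square gives a sum of covariances. For different primes each is at most 4, and
  \<open>(\<Sum>\<bar>g Q\<bar>)\<^sup>2 \<le> pp_var g y * (\<Sum>Q) \<le> pp_var g y * y\<^sup>2\<close>, so \<open>y\<^sup>2 \<le> n\<close> is exactly what keeps
  the accumulated rounding errors below the main term. For powers of the same prime
  \<open>\<bar>g Q\<bar> \<bar>g R\<bar>\<close> is bounded by the mean of the squares, and the sum of \<open>1 / R\<close> over powers of one prime is at most 1.
\<close>

lemma small_part_variance:
  assumes y: "y * y \<le> n"
  shows "(\<Sum>k=1..n. (\<Sum>Q\<in>primepows_upto y. g Q * (exactly Q k - exact_density Q))\<^sup>2) \<le> 8 * real n * pp_var g y"
proof -
  let ?P = "primepows_upto y"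
  let ?same = "\<lambda>Q R. of_bool (aprimedivisor Q = aprimedivisor R) :: real"
  have pos: "Q > 0" "prime (aprimedivisor Q)" if "Q \<in> ?P" for Q
    using primepow_and_base_ge_2[of Q] that by auto
  have "(\<Sum>k=1..n. (\<Sum>Q\<in>?P. g Q * (exactly Q k - exact_density Q))\<^sup>2)
      = (\<Sum>k=1..n. \<Sum>Q\<in>?P. \<Sum>R\<in>?P. g Q * g R * ((exactly Q k - exact_density Q) * (exactly R k - exact_density R)))"
    by (simp add: power2_eq_square sum_product mult_ac)
  also have "\<dots> = (\<Sum>Q\<in>?P. \<Sum>R\<in>?P. g Q * g R * exact_cov n Q R)"
    unfolding exact_cov_def sum_distrib_left
    by (subst sum.swap) (intro sum.cong refl sum.swap)
  \<comment> \<open>The bound by the mean of the squares is split into two halves, each carrying the square of one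
    index only; exchanging the indices turns one half into the other.\<close>
  also have "\<dots> \<le> (\<Sum>Q\<in>?P. \<Sum>R\<in>?P. 4 * (\<bar>g Q\<bar> * \<bar>g R\<bar>) + of_bool (Q = R) * (real n * ((g Q)\<^sup>2 / real Q))
      + 3/2 * real n * (?same Q R * ((g Q)\<^sup>2 / real Q) * (1 / real R))
      + 3/2 * real n * (?same R Q * ((g R)\<^sup>2 / real R) * (1 / real Q)))"
  proof (intro sum_mono)
    fix Q R assume Q: "Q \<in> ?P" and R: "R \<in> ?P"
    have le: "g Q * g R * exact_cov n Q R \<le> (\<bar>g Q\<bar> * \<bar>g R\<bar>) * \<bar>exact_cov n Q R\<bar>"
      by (metis abs_ge_self abs_mult)
    show "g Q * g R * exact_cov n Q R \<le> 4 * (\<bar>g Q\<bar> * \<bar>g R\<bar>) + of_bool (Q = R) * (real n * ((g Q)\<^sup>2 / real Q))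
      + 3/2 * real n * (?same Q R * ((g Q)\<^sup>2 / real Q) * (1 / real R))
      + 3/2 * real n * (?same R Q * ((g R)\<^sup>2 / real R) * (1 / real Q))"
    proof (cases "aprimedivisor Q = aprimedivisor R")
      case False
      hence "(\<bar>g Q\<bar> * \<bar>g R\<bar>) * \<bar>exact_cov n Q R\<bar> \<le> (\<bar>g Q\<bar> * \<bar>g R\<bar>) * 4"
        using exact_cov_coprime[of Q R n] Q R by (intro mult_left_mono) auto
      hence "g Q * g R * exact_cov n Q R \<le> 4 * (\<bar>g Q\<bar> * \<bar>g R\<bar>)" using le by linarith
      moreover have "Q \<noteq> R" using False by auto
      ultimately show ?thesis using False by simp
    next
      case True
      let ?d = "real n / (real Q * real R)"
      have 1: "(\<bar>g Q\<bar> * \<bar>g R\<bar>) * \<bar>exact_cov n Q R\<bar> \<le> (\<bar>g Q\<bar> * \<bar>g R\<bar>) * (of_bool (Q = R) * (real n / real Q) + 3 * ?d)"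
        using exact_cov_same_prime[of Q R n] Q R True by (intro mult_left_mono) auto
      have 2: "\<bar>g Q\<bar> * \<bar>g R\<bar> \<le> ((g Q)\<^sup>2 + (g R)\<^sup>2) / 2"
        using sum_squares_bound[of "\<bar>g Q\<bar>" "\<bar>g R\<bar>"] by simp
      have 3: "(\<bar>g Q\<bar> * \<bar>g R\<bar>) * (3 * ?d) \<le> (((g Q)\<^sup>2 + (g R)\<^sup>2) / 2) * (3 * ?d)"
        by (intro mult_right_mono 2) auto
      have 4: "(\<bar>g Q\<bar> * \<bar>g R\<bar>) * (of_bool (Q = R) * (real n / real Q)) = of_bool (Q = R) * (real n * ((g Q)\<^sup>2 / real Q))"
        by (auto simp: power2_eq_square)
      have 5: "(((g Q)\<^sup>2 + (g R)\<^sup>2) / 2) * (3 * ?d) = 3/2 * real n * (?same Q R * ((g Q)\<^sup>2 / real Q) * (1 / real R))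
          + 3/2 * real n * (?same R Q * ((g R)\<^sup>2 / real R) * (1 / real Q))"
        using True pos(1)[OF Q] pos(1)[OF R] by (simp add: field_simps)
      have "0 \<le> 4 * (\<bar>g Q\<bar> * \<bar>g R\<bar>)" by simp
      thus ?thesis using le 1 3 4 5 unfolding distrib_left by linarith
    qed
  qed
  also have "\<dots> = 4 * (\<Sum>Q\<in>?P. \<bar>g Q\<bar>)\<^sup>2 + real n * pp_var g y
      + 3 * real n * (\<Sum>Q\<in>?P. (g Q)\<^sup>2 / real Q * (\<Sum>R\<in>?P. ?same Q R * (1 / real R)))"
  proof -
    let ?X = "\<Sum>Q\<in>?P. \<Sum>R\<in>?P. ?same Q R * ((g Q)\<^sup>2 / real Q) * (1 / real R)"
    have "(\<Sum>Q\<in>?P. \<Sum>R\<in>?P. 4 * (\<bar>g Q\<bar> * \<bar>g R\<bar>)) = 4 * (\<Sum>Q\<in>?P. \<bar>g Q\<bar>)\<^sup>2"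
      unfolding power2_eq_square sum_product by (simp only: sum_distrib_left)
    moreover have "(\<Sum>Q\<in>?P. \<Sum>R\<in>?P. of_bool (Q = R) * (real n * ((g Q)\<^sup>2 / real Q))) = real n * pp_var g y"
    proof -
      have "(\<Sum>R\<in>?P. of_bool (Q = R) * c) = c" if "Q \<in> ?P" for Q and c :: real
        using that by (subst sum.remove[of _ Q]) (auto intro!: sum.neutral)
      thus ?thesis unfolding pp_var_def sum_distrib_left by (intro sum.cong refl) blast
    qed
    moreover have "(\<Sum>Q\<in>?P. \<Sum>R\<in>?P. 3/2 * real n * (?same R Q * ((g R)\<^sup>2 / real R) * (1 / real Q)))
        = 3/2 * real n * ?X"
      unfolding sum_distrib_left by (rule sum.swap)
    moreover have "(\<Sum>Q\<in>?P. \<Sum>R\<in>?P. 3/2 * real n * (?same Q R * ((g Q)\<^sup>2 / real Q) * (1 / real R)))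
        = 3/2 * real n * ?X"
      unfolding sum_distrib_left ..
    moreover have "?X = (\<Sum>Q\<in>?P. (g Q)\<^sup>2 / real Q * (\<Sum>R\<in>?P. ?same Q R * (1 / real R)))"
      unfolding sum_distrib_left by (intro sum.cong refl) (simp add: mult_ac)
    ultimately show ?thesis unfolding sum.distrib by simp
  qed
  also have "\<dots> \<le> 4 * (pp_var g y * real n) + real n * pp_var g y + 3 * real n * (pp_var g y)"
  proof (intro add_mono mult_left_mono order.refl)
    have "(\<Sum>Q\<in>?P. real Q) \<le> (\<Sum>Q\<in>{1..y}. real y)"
      using pos by (intro order.trans[OF sum_mono2[of "{1..y}"] sum_mono]) (auto simp: Suc_le_eq)
    also have "\<dots> \<le> real n" using y by (simp flip: of_nat_mult)
    finally have "pp_var g y * (\<Sum>Q\<in>?P. real Q) \<le> pp_var g y * real n"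
      by (intro mult_left_mono pp_var_nonneg)
    moreover have "(\<Sum>Q\<in>?P. \<bar>g Q\<bar>)\<^sup>2 \<le> pp_var g y * (\<Sum>Q\<in>?P. real Q)"
      using weighted_Cauchy_Schwarz[of ?P g "\<lambda>_. 1"] pos by (simp add: pp_var_def)
    ultimately show "(\<Sum>Q\<in>?P. \<bar>g Q\<bar>)\<^sup>2 \<le> pp_var g y * real n" by linarith
    show "(\<Sum>Q\<in>?P. (g Q)\<^sup>2 / real Q * (\<Sum>R\<in>?P. ?same Q R * (1 / real R))) \<le> pp_var g y"
      unfolding pp_var_def
    proof (intro sum_mono)
      fix Q assume Q: "Q \<in> ?P"
      have "(\<Sum>R\<in>?P. ?same Q R * (1 / real R)) = (\<Sum>R | primepow R \<and> R \<le> y \<and> aprimedivisor R = aprimedivisor Q. 1 / real R)"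
        by (intro sum.mono_neutral_cong_right) auto
      also have "\<dots> \<le> 1" by (rule sum_inverse_same_prime[OF pos(2)[OF Q]])
      finally have "(g Q)\<^sup>2 / real Q * (\<Sum>R\<in>?P. ?same Q R * (1 / real R)) \<le> (g Q)\<^sup>2 / real Q * 1"
        by (intro mult_left_mono) auto
      thus "(g Q)\<^sup>2 / real Q * (\<Sum>R\<in>?P. ?same Q R * (1 / real R)) \<le> (g Q)\<^sup>2 / real Q" by simp
    qed
  qed auto
  finally show ?thesis by (simp add: algebra_simps)
qed

text \<open>
  Two distinct prime powers that divide \<open>k\<close> exactly are coprime, so their product divides \<open>k\<close>; if
  both exceed \<open>y\<close>, this product is too large.
\<close>

lemma large_part_sparse:
  assumes "primepow Q" "primepow R" "Q \<noteq> R" "y < Q" "y < R" "1 \<le> k" "k < (y + 1) * (y + 1)"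
  shows "exactly Q k * exactly R k = 0"
proof (cases "aprimedivisor Q = aprimedivisor R")
  case True
  thus ?thesis using exactly_same_prime assms by blast
next
  case False
  have "coprime Q R" using coprime_primepow[OF assms(1,2) False, of 0 0] by simp
  moreover have "\<not> Q * R dvd k"
  proof
    assume "Q * R dvd k"
    hence "Q * R \<le> k" using assms by (intro dvd_imp_le) auto
    moreover have "(y + 1) * (y + 1) \<le> Q * R" using assms by (intro mult_le_mono) auto
    ultimately show False using assms by linarith
  qed
  ultimately have "\<not> (Q dvd k \<and> R dvd k)" using divides_mult by blast
  thus ?thesis by (auto simp: exactly_eq_of_bool)
qed

lemma square_sum_disjoint:
  fixes f :: "'i \<Rightarrow> real"
  assumes "finite S" "\<And>i j. i \<in> S \<Longrightarrow> j \<in> S \<Longrightarrow> i \<noteq> j \<Longrightarrow> f i * f j = 0"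
  shows "(\<Sum>i\<in>S. f i)\<^sup>2 = (\<Sum>i\<in>S. (f i)\<^sup>2)"
proof -
  have "(\<Sum>i\<in>S. f i)\<^sup>2 = (\<Sum>i\<in>S. \<Sum>j\<in>S. f i * f j)" by (simp add: power2_eq_square sum_product)
  also have "\<dots> = (\<Sum>i\<in>S. (f i)\<^sup>2)"
  proof (intro sum.cong refl)
    fix i assume "i \<in> S"
    hence "(\<Sum>j\<in>S. f i * f j) = f i * f i + (\<Sum>j\<in>S - {i}. f i * f j)"
      by (intro sum.remove assms)
    also have "(\<Sum>j\<in>S - {i}. f i * f j) = 0"
      using assms(2) \<open>i \<in> S\<close> by (intro sum.neutral) blast
    finally show "(\<Sum>j\<in>S. f i * f j) = (f i)\<^sup>2" by (simp add: power2_eq_square)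
  qed
  finally show ?thesis .
qed

lemma large_part_second_moment:
  assumes "n < (y + 1) * (y + 1)"
  shows "(\<Sum>k=1..n. (\<Sum>Q\<in>primepows_upto n - primepows_upto y. g Q * exactly Q k)\<^sup>2) \<le> real n * pp_var g n"
proof -
  let ?S = "primepows_upto n - primepows_upto y"
  have "(\<Sum>k=1..n. (\<Sum>Q\<in>?S. g Q * exactly Q k)\<^sup>2) = (\<Sum>k=1..n. \<Sum>Q\<in>?S. (g Q * exactly Q k)\<^sup>2)"
  proof (intro sum.cong refl square_sum_disjoint)
    fix k Q R assume k: "k \<in> {1..n}" and QR: "Q \<in> ?S" "R \<in> ?S" "Q \<noteq> R"
    have "exactly Q k * exactly R k = 0"
      by (rule large_part_sparse[of Q R y]) (use k QR assms in auto)
    thus "g Q * exactly Q k * (g R * exactly R k) = 0" by auto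
  qed auto
  also have "\<dots> = (\<Sum>k=1..n. \<Sum>Q\<in>?S. (g Q)\<^sup>2 * exactly Q k)"
    by (intro sum.cong refl) (auto simp: power2_eq_square exactly_eq_of_bool)
  also have "\<dots> = (\<Sum>Q\<in>?S. (g Q)\<^sup>2 * (\<Sum>k=1..n. exactly Q k))"
    unfolding sum_distrib_left by (rule sum.swap)
  also have "\<dots> \<le> (\<Sum>Q\<in>?S. (g Q)\<^sup>2 * (real n / real Q))"
    by (intro sum_mono mult_left_mono sum_exactly_le) auto
  also have "\<dots> = real n * (\<Sum>Q\<in>?S. (g Q)\<^sup>2 / real Q)"
    unfolding sum_distrib_left by (intro sum.cong) auto
  also have "\<dots> \<le> real n * pp_var g n"
    unfolding pp_var_def by (intro mult_left_mono sum_mono2) auto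
  finally show ?thesis .
qed

text \<open>
  Each \<open>k \<le> n\<close> is divided exactly by at most one prime power above \<open>y\<close>, while each such \<open>Q\<close> is hit by at
  least \<open>n / (4 Q)\<close> integers; counting the pairs in both orders gives the bound.
\<close>

lemma sum_inverse_large_primepows:
  assumes "n < (y + 1) * (y + 1)"
  shows "(\<Sum>Q\<in>primepows_upto n - primepows_upto y. 1 / real Q) \<le> 4"
proof (cases "n = 0")
  case False
  let ?S = "primepows_upto n - primepows_upto y"
  have "real n / 4 * (\<Sum>Q\<in>?S. 1 / real Q) \<le> (\<Sum>Q\<in>?S. \<Sum>k=1..n. exactly Q k)"
    unfolding sum_distrib_left
    using sum_exactly_ge[of _ n] by (intro sum_mono) auto
  also have "\<dots> = (\<Sum>k=1..n. \<Sum>Q\<in>?S. exactly Q k)" by (rule sum.swap)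
  also have "\<dots> \<le> (\<Sum>k=1..n. 1)"
  proof (intro sum_mono)
    fix k assume k: "k \<in> {1..n}"
    have "(\<Sum>Q\<in>?S. exactly Q k)\<^sup>2 = (\<Sum>Q\<in>?S. (exactly Q k)\<^sup>2)"
      by (intro square_sum_disjoint large_part_sparse[of _ _ y]) (use k assms in auto)
    also have "\<dots> = (\<Sum>Q\<in>?S. exactly Q k)" by (intro sum.cong refl) (simp add: exactly_eq_of_bool)
    finally show "(\<Sum>Q\<in>?S. exactly Q k) \<le> 1" by (auto simp: power2_eq_square)
  qed
  finally show ?thesis using False by (simp add: field_simps)
qed (use primepow_and_base_ge_2 in auto)

lemma sum_inverse_squares_le: "(\<Sum>q=2..n. 1 / (real q)\<^sup>2) \<le> 1"
proof -
  have "(\<Sum>q=2..n. 1 / (real q)\<^sup>2) \<le> 1 - 1 / real (max n 1)"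
  proof (induction n)
    case (Suc n)
    show ?case
    proof (cases "n = 0")
      case False
      hence "1 / (real (Suc n))\<^sup>2 \<le> 1 / real n - 1 / real (Suc n)"
      proof -
        have "1 / (real (Suc n))\<^sup>2 \<le> 1 / (real n * real (Suc n))"
          using False by (intro divide_left_mono) (auto simp: power2_eq_square)
        thus ?thesis using False by (simp add: field_simps)
      qed
      thus ?thesis using Suc False by simp
    qed auto
  qed auto
  also have "\<dots> \<le> 1" by simp
  finally show ?thesis .
qed

text \<open>
  The densities \<open>1/Q - 1/(q Q)\<close> differ from the weights \<open>1/Q\<close> of \<open>pp_mean\<close> by a square-summable
  amount; this is the constant in the Cauchy-Schwarz estimate of the difference.
\<close>

lemma sum_primepow_correction:
  "(\<Sum>Q\<in>primepows_upto y. real Q * (1 / real (aprimedivisor Q * Q))\<^sup>2) \<le> 1"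
proof -
  let ?P = "primepows_upto y"
  have img: "aprimedivisor ` ?P \<subseteq> {2..y}"
    using primepow_and_base_ge_2 by (auto intro: order.trans[OF aprimedivisor_le_nat[OF primepow_gt_Suc_0]])
  have pr: "prime q" if "q \<in> aprimedivisor ` ?P" for q using that primepow_and_base_ge_2 by auto
  have "(\<Sum>Q\<in>?P. real Q * (1 / real (aprimedivisor Q * Q))\<^sup>2) = (\<Sum>Q\<in>?P. 1 / (real (aprimedivisor Q))\<^sup>2 * (1 / real Q))"
    using primepow_and_base_ge_2 by (intro sum.cong refl) (auto simp: power2_eq_square)
  also have "\<dots> = (\<Sum>q\<in>aprimedivisor ` ?P. \<Sum>Q | Q \<in> ?P \<and> aprimedivisor Q = q. 1 / (real (aprimedivisor Q))\<^sup>2 * (1 / real Q))"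
    by (rule sum.image_gen) simp
  also have "\<dots> = (\<Sum>q\<in>aprimedivisor ` ?P. 1 / (real q)\<^sup>2 * (\<Sum>Q | primepow Q \<and> Q \<le> y \<and> aprimedivisor Q = q. 1 / real Q))"
    unfolding sum_distrib_left by (intro sum.cong refl) auto
  also have "\<dots> \<le> (\<Sum>q\<in>aprimedivisor ` ?P. 1 / (real q)\<^sup>2 * 1)"
    by (intro sum_mono mult_left_mono sum_inverse_same_prime pr) auto
  also have "\<dots> \<le> (\<Sum>q=2..y. 1 / (real q)\<^sup>2)"
    using img by (simp only: mult_1_right) (intro sum_mono2, auto)
  also have "\<dots> \<le> 1" by (rule sum_inverse_squares_le)
  finally show ?thesis .
qed

text \<open>
  Split at \<open>y\<close>, the integer part of \<open>sqrt n\<close>: \<open>g k - pp_mean g n = X k + Y k + c\<close>, where \<open>X\<close> is the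
  centred contribution of the prime powers up to \<open>y\<close>, \<open>Y\<close> that of the larger ones, and \<open>c\<close> corrects
  the centring. Each has mean square \<open>O(pp_var g n)\<close>, and \<open>54 = 3 * (8 + 1 + 9)\<close>.
\<close>

theorem Turan_Kubilius:
  assumes g: "additive_arith g"
  shows "(\<Sum>k=1..n. (g k - pp_mean g n)\<^sup>2) \<le> 54 * (real n * pp_var g n)"
proof -
  have "\<exists>y. y * y \<le> n \<and> n < (y + 1) * (y + 1)"
  proof (induction n)
    case (Suc n)
    then obtain y where "y * y \<le> n" "n < (y + 1) * (y + 1)" by blast
    thus ?case
      by (cases "Suc n < (y + 1) * (y + 1)") (intro exI[of _ y], simp, intro exI[of _ "y + 1"], simp)
  qed simp
  then obtain y where y: "y * y \<le> n" "n < (y + 1) * (y + 1)" by blast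
  have "y \<le> n" using y(1) by (cases y) auto
  let ?P = "primepows_upto y" and ?S = "primepows_upto n - primepows_upto y"
  have un: "primepows_upto n = ?P \<union> ?S" "?P \<inter> ?S = {}" using \<open>y \<le> n\<close> by auto
  have posn: "\<And>Q. Q \<in> ?P \<Longrightarrow> Q > 0" "\<And>Q. Q \<in> ?S \<Longrightarrow> Q > 0" using primepow_and_base_ge_2 by force+
  define b where "b = sqrt (pp_var g n)"
  have b: "b \<ge> 0" "b\<^sup>2 = pp_var g n" using pp_var_nonneg[of g n] by (auto simp: b_def)
  have abs_le: "x \<le> c * b" if "x\<^sup>2 \<le> v * u" "v \<le> pp_var g n" "u \<le> c\<^sup>2" "0 \<le> u" "c \<ge> 0" for x v u c :: real
  proof -
    have "v * u \<le> pp_var g n * c\<^sup>2" using that pp_var_nonneg[of g n] by (intro mult_mono) auto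
    hence "x\<^sup>2 \<le> (c * b)\<^sup>2" using that b by (simp add: power_mult_distrib mult.commute)
    thus ?thesis by (rule power2_le_imp_le) (use that b in auto)
  qed
  define X where "X k = (\<Sum>Q\<in>?P. g Q * (exactly Q k - exact_density Q))" for k
  define Y where "Y k = (\<Sum>Q\<in>?S. g Q * exactly Q k)" for k
  \<comment> \<open>The small part is centred at its own densities and the large part not at all, whereas the
    theorem centres at the sum of \<open>g Q / Q\<close> over all prime powers up to \<open>n\<close>.\<close>
  define c where "c = (\<Sum>Q\<in>?P. g Q * exact_density Q) - pp_mean g n"
  have c: "\<bar>c\<bar> \<le> 3 * b"
  proof -
    have "pp_mean g n = (\<Sum>Q\<in>?P. g Q / real Q) + (\<Sum>Q\<in>?S. g Q / real Q)"
      unfolding pp_mean_def by (subst un(1), rule sum.union_disjoint) (use un in auto)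
    hence "c = - (\<Sum>Q\<in>?P. g Q * (1 / real (aprimedivisor Q * Q))) - (\<Sum>Q\<in>?S. g Q * (1 / real Q))"
      by (simp add: c_def exact_density_def right_diff_distrib sum_subtractf)
    moreover have "\<bar>\<Sum>Q\<in>?P. g Q * (1 / real (aprimedivisor Q * Q))\<bar> \<le> 1 * b"
    proof (rule order.trans[OF order.trans[OF sum_abs] abs_le])
      show "(\<Sum>Q\<in>?P. \<bar>g Q * (1 / real (aprimedivisor Q * Q))\<bar>) \<le> (\<Sum>Q\<in>?P. \<bar>g Q\<bar> * (1 / real (aprimedivisor Q * Q)))"
        by (intro sum_mono) (simp add: abs_mult)
      show "(\<Sum>Q\<in>?P. \<bar>g Q\<bar> * (1 / real (aprimedivisor Q * Q)))\<^sup>2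
         \<le> pp_var g y * (\<Sum>Q\<in>?P. real Q * (1 / real (aprimedivisor Q * Q))\<^sup>2)"
        unfolding pp_var_def by (rule weighted_Cauchy_Schwarz) (use posn in auto)
    qed (use sum_primepow_correction[of y] pp_var_mono[OF \<open>y \<le> n\<close>, of g] in \<open>auto intro!: sum_nonneg\<close>)
    moreover have "\<bar>\<Sum>Q\<in>?S. g Q * (1 / real Q)\<bar> \<le> 2 * b"
    proof (rule order.trans[OF order.trans[OF sum_abs] abs_le])
      show "(\<Sum>Q\<in>?S. \<bar>g Q * (1 / real Q)\<bar>) \<le> (\<Sum>Q\<in>?S. \<bar>g Q\<bar> * (1 / real Q))"
        by (intro sum_mono) (simp add: abs_mult)
      show "(\<Sum>Q\<in>?S. \<bar>g Q\<bar> * (1 / real Q))\<^sup>2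
         \<le> (\<Sum>Q\<in>?S. (g Q)\<^sup>2 / real Q) * (\<Sum>Q\<in>?S. real Q * (1 / real Q)\<^sup>2)"
        by (rule weighted_Cauchy_Schwarz) (use posn in auto)
      show "(\<Sum>Q\<in>?S. (g Q)\<^sup>2 / real Q) \<le> pp_var g n"
        unfolding pp_var_def by (intro sum_mono2) auto
      have "(\<Sum>Q\<in>?S. real Q * (1 / real Q)\<^sup>2) = (\<Sum>Q\<in>?S. 1 / real Q)"
        by (intro sum.cong refl) (auto simp: power2_eq_square)
      thus "(\<Sum>Q\<in>?S. real Q * (1 / real Q)\<^sup>2) \<le> 2\<^sup>2"
        using sum_inverse_large_primepows[OF y(2)] by simp
    qed (auto intro!: sum_nonneg)
    ultimately show ?thesis by linarith
  qed
  have decomp: "g k - pp_mean g n = X k + Y k + c" if "k \<in> {1..n}" for k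
  proof -
    have "g k = (\<Sum>Q\<in>?P. g Q * exactly Q k) + Y k"
      unfolding Y_def using that additive_arith_eq_sum[OF g, of k n]
      by (subst sum.union_disjoint[symmetric]) (use un in auto)
    thus ?thesis by (simp add: X_def c_def right_diff_distrib sum_subtractf)
  qed
  have "(\<Sum>k=1..n. (g k - pp_mean g n)\<^sup>2) \<le> (\<Sum>k=1..n. 3 * (X k)\<^sup>2 + 3 * (Y k)\<^sup>2 + 3 * c\<^sup>2)"
  proof (intro sum_mono)
    fix k assume k: "k \<in> {1..n}"
    have "3 * x\<^sup>2 + 3 * z\<^sup>2 + 3 * w\<^sup>2 - (x + z + w)\<^sup>2 = (x - z)\<^sup>2 + (x - w)\<^sup>2 + (z - w)\<^sup>2" for x z w :: real
      by (simp add: power2_eq_square algebra_simps)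
    from this[of "X k" "Y k" c] show "(g k - pp_mean g n)\<^sup>2 \<le> 3 * (X k)\<^sup>2 + 3 * (Y k)\<^sup>2 + 3 * c\<^sup>2"
      unfolding decomp[OF k] by (smt (verit) zero_le_power2)
  qed
  also have "\<dots> = 3 * (\<Sum>k=1..n. (X k)\<^sup>2) + 3 * (\<Sum>k=1..n. (Y k)\<^sup>2) + 3 * (real n * c\<^sup>2)"
    by (simp add: sum.distrib sum_distrib_left)
  finally have "(\<Sum>k=1..n. (g k - pp_mean g n)\<^sup>2) \<le> 3 * (\<Sum>k=1..n. (X k)\<^sup>2) + 3 * (\<Sum>k=1..n. (Y k)\<^sup>2) + 3 * (real n * c\<^sup>2)" .
  also have "\<dots> \<le> 3 * (8 * real n * pp_var g n) + 3 * (real n * pp_var g n) + 3 * (real n * (9 * pp_var g n))"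
  proof (intro add_mono mult_left_mono)
    have "8 * real n * pp_var g y \<le> 8 * real n * pp_var g n"
      using pp_var_mono[OF \<open>y \<le> n\<close>, of g] by (intro mult_left_mono) auto
    thus "(\<Sum>k=1..n. (X k)\<^sup>2) \<le> 8 * real n * pp_var g n"
      unfolding X_def using small_part_variance[OF y(1), of g] by linarith
    show "(\<Sum>k=1..n. (Y k)\<^sup>2) \<le> real n * pp_var g n"
      unfolding Y_def by (rule large_part_second_moment[OF y(2)])
    have "\<bar>c\<bar>\<^sup>2 \<le> (3 * b)\<^sup>2" using c by (intro power_mono) auto
    thus "c\<^sup>2 \<le> 9 * pp_var g n" using b by (simp add: power_mult_distrib)
  qed auto
  also have "\<dots> = 54 * (real n * pp_var g n)" by (simp add: algebra_simps)
  finally show ?thesis .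
qed

section \<open>Additive functions as nearly constant weights\<close>

text \<open>
  A jump that crosses zero has absolute value at least that of its endpoint.
\<close>

lemma eventually_constant_sign:
  fixes A :: "nat \<Rightarrow> real"
  assumes "\<forall>\<^sub>F n in sequentially. A (Suc n) \<noteq> 0 \<and> \<bar>A (Suc n) - A n\<bar> \<le> \<bar>A (Suc n)\<bar> / 2"
  shows "\<exists>s. \<forall>\<^sub>F n in sequentially. sgn (A n) = s"
proof -
  obtain N where N: "\<And>n. n \<ge> N \<Longrightarrow> A (Suc n) \<noteq> 0 \<and> \<bar>A (Suc n) - A n\<bar> \<le> \<bar>A (Suc n)\<bar> / 2"
    using assms unfolding eventually_sequentially by blast
  have "sgn (A n) = sgn (A N)" if "n \<ge> N" for n
    using that
  proof (induction n rule: dec_induct)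
    case (step n)
    have "sgn (A (Suc n)) = sgn (A n)" using N[OF step.hyps(1)] by (cases "A (Suc n) > 0") (auto simp: sgn_if abs_if split: if_splits)
    thus ?case using step.IH by simp
  qed simp
  thus ?thesis unfolding eventually_sequentially by blast
qed

text \<open>
  An increment of \<open>pp_mean\<close> is a single term \<open>g m / m\<close>, whose square is at most the term
  \<open>(g m)\<^sup>2 / m\<close> of \<open>pp_var\<close>.
\<close>

lemma pp_mean_Suc_diff: "\<bar>pp_mean g (Suc n) - pp_mean g n\<bar> \<le> sqrt (pp_var g (Suc n))"
proof (cases "primepow (Suc n)")
  case True
  have "primepows_upto (Suc n) = insert (Suc n) (primepows_upto n)" using True by (auto simp: le_Suc_eq)
  hence "pp_mean g (Suc n) - pp_mean g n = g (Suc n) / real (Suc n)"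
    unfolding pp_mean_def by (simp del: of_nat_Suc)
  moreover have "(g (Suc n) / real (Suc n))\<^sup>2 \<le> (g (Suc n))\<^sup>2 / real (Suc n)"
    unfolding power_divide by (intro divide_left_mono) (auto simp: power2_eq_square)
  moreover have "(g (Suc n))\<^sup>2 / real (Suc n) \<le> pp_var g (Suc n)"
    unfolding pp_var_def using True by (intro member_le_sum) auto
  ultimately have "(pp_mean g (Suc n) - pp_mean g n)\<^sup>2 \<le> pp_var g (Suc n)" by (metis order.trans)
  thus ?thesis by (intro real_le_rsqrt) simp
next
  case False
  hence "primepows_upto (Suc n) = primepows_upto n" by (auto simp: le_Suc_eq)
  thus ?thesis using pp_var_nonneg[of g "Suc n"] unfolding pp_mean_def by simp
qed

text \<open>
  A nonzero additive function is nonzero at some prime power, which contributes to all later sums.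
\<close>

lemma eventually_pp_var_ge:
  assumes g: "additive_arith g" and nz: "\<exists>n\<ge>1. g n \<noteq> 0"
  shows "\<exists>\<delta>>0. \<forall>\<^sub>F n in sequentially. \<delta> \<le> sqrt (pp_var g n)"
proof -
  obtain m where m: "m \<ge> 1" "g m \<noteq> 0" using nz by blast
  have "\<exists>Q\<in>primepows_upto m. g Q * exactly Q m \<noteq> 0"
    using additive_arith_eq_sum[OF g m(1) order_refl] m(2) by (metis (no_types, lifting) sum.neutral)
  then obtain Q where Q: "primepow Q" "g Q \<noteq> 0" by auto
  have "\<forall>\<^sub>F n in sequentially. sqrt ((g Q)\<^sup>2 / real Q) \<le> sqrt (pp_var g n)"
    using eventually_ge_at_top[of Q]
  proof eventually_elim
    case (elim n)
    show ?case unfolding pp_var_def using Q elim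
      by (intro real_sqrt_le_mono member_le_sum[of Q _ "\<lambda>m. (g m)\<^sup>2 / real m"]) auto
  qed
  moreover have "sqrt ((g Q)\<^sup>2 / real Q) > 0" using Q primepow_and_base_ge_2(1)[of Q] by auto
  ultimately show ?thesis by blast
qed

text \<open>
  Normalized so that it is comparable with \<open>weight_sum w n\<close>: both scale like \<open>n\<close> times a typical
  weight, and Cauchy-Schwarz bounds \<open>(\<Sum>k=1..n. \<bar>w k - c n\<bar>)\<close> by it.
\<close>

definition deviation :: "(nat \<Rightarrow> real) \<Rightarrow> (nat \<Rightarrow> real) \<Rightarrow> nat \<Rightarrow> real" where
  "deviation w c n = sqrt (real n * (\<Sum>k=1..n. (w k - c n)\<^sup>2))"

text \<open>
  This collects all that the ergodic part uses about the weight: in quadratic mean over \<open>{1..n}\<close>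
  the weight is the constant \<open>c n\<close>, up to an error small against the mean absolute weight.
\<close>

definition concentrated_weight :: "(nat \<Rightarrow> real) \<Rightarrow> (nat \<Rightarrow> real) \<Rightarrow> bool" where
  "concentrated_weight w c \<longleftrightarrow>
     admissible_weight w \<and> convergent (\<lambda>n. real n * c n / weight_sum w n) \<and>
     (\<lambda>n. deviation w c n / weight_sum w n) \<longlonglongrightarrow> 0"

lemma weight_sum_deviation:
  "\<bar>weight_sum w n - real n * \<bar>c n\<bar>\<bar> \<le> deviation w c n"
proof -
  have "\<bar>weight_sum w n - real n * \<bar>c n\<bar>\<bar> = \<bar>\<Sum>k=1..n. \<bar>w k\<bar> - \<bar>c n\<bar>\<bar>"
    by (simp add: weight_sum_def sum_subtractf)
  also have "\<dots> \<le> (\<Sum>k=1..n. \<bar>\<bar>w k\<bar> - \<bar>c n\<bar>\<bar>)" by (rule sum_abs)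
  also have "\<dots> \<le> (\<Sum>k=1..n. \<bar>w k - c n\<bar>)" by (intro sum_mono) (rule abs_triangle_ineq3)
  also have "\<dots> \<le> deviation w c n"
    unfolding deviation_def using Cauchy_Schwarz_ineq_sum[of "\<lambda>_. 1" "\<lambda>k. \<bar>w k - c n\<bar>" "{1..n}"]
    by (intro real_le_rsqrt) simp
  finally show ?thesis .
qed

text \<open>
  By the Turan-Kubilius inequality the deviation of \<open>g\<close> from \<open>pp_mean g n\<close> is at most
  \<open>8 n sqrt (pp_var g n)\<close>, and this is \<open>o(n \<bar>pp_mean g n\<bar>)\<close> by hypothesis. Hence \<open>weight_sum g n\<close> is
  asymptotic to \<open>n \<bar>pp_mean g n\<bar>\<close>, and the three conditions follow from the eventually constant sign
  of \<open>pp_mean g n\<close> and from the positive lower bound for \<open>pp_var g n\<close>.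
\<close>

theorem additive_concentrated:
  assumes g: "additive_arith g" and nz: "\<exists>n\<ge>1. g n \<noteq> 0"
    and small: "(\<lambda>n. sqrt (pp_var g n)) \<in> o(pp_mean g)"
  shows "concentrated_weight g (pp_mean g)"
proof -
  let ?A = "pp_mean g" and ?b = "\<lambda>n. sqrt (pp_var g n)" and ?W = "weight_sum g" and ?D = "deviation g (pp_mean g)"
  have dev: "?D n \<le> 8 * (real n * ?b n)" for n
  proof -
    have "?D n \<le> sqrt (real n * (54 * (real n * pp_var g n)))"
      unfolding deviation_def by (intro real_sqrt_le_mono mult_left_mono Turan_Kubilius g) simp
    also have "\<dots> \<le> sqrt ((8 * (real n * ?b n))\<^sup>2)"
    proof (rule real_sqrt_le_mono)
      have "real n * (54 * (real n * pp_var g n)) = 54 * ((real n)\<^sup>2 * pp_var g n)"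
        by (simp add: power2_eq_square)
      also have "\<dots> \<le> 64 * ((real n)\<^sup>2 * pp_var g n)"
        using pp_var_nonneg[of g n] by (intro mult_right_mono) auto
      also have "\<dots> = (8 * (real n * ?b n))\<^sup>2"
        using pp_var_nonneg[of g n] by (simp add: power_mult_distrib)
      finally show "real n * (54 * (real n * pp_var g n)) \<le> (8 * (real n * ?b n))\<^sup>2" .
    qed
    also have "\<dots> = 8 * (real n * ?b n)"
      by (rule real_sqrt_unique) (auto simp: pp_var_nonneg)
    finally show ?thesis .
  qed
  have D0: "0 \<le> ?D n" for n unfolding deviation_def by (simp add: sum_nonneg)
  obtain \<delta> where \<delta>: "\<delta> > 0" "\<forall>\<^sub>F n in sequentially. \<delta> \<le> ?b n"
    using eventually_pp_var_ge[OF g nz] by blast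
  have b16: "\<forall>\<^sub>F n in sequentially. ?b n \<le> \<bar>?A n\<bar> / 16"
    using landau_o.smallD[OF small, of "1/16"] by (simp add: pp_var_nonneg)
  have A0: "\<forall>\<^sub>F n in sequentially. ?A n \<noteq> 0"
    using b16 \<delta>(2) by eventually_elim (use \<delta>(1) in auto)
  have Wge: "\<forall>\<^sub>F n in sequentially. real n * \<bar>?A n\<bar> / 2 \<le> ?W n"
    using b16
  proof eventually_elim
    case (elim n)
    have "8 * (real n * ?b n) \<le> 8 * (real n * (\<bar>?A n\<bar> / 16))" by (intro mult_left_mono elim) auto
    thus ?case using weight_sum_deviation[of g n ?A] dev[of n] by simp
  qed
  have ratio_b: "(\<lambda>n. ?b n / \<bar>?A n\<bar>) \<longlonglongrightarrow> 0"
    using tendsto_rabs[OF smalloD_tendsto[OF small]] by (simp add: pp_var_nonneg)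
  have D_A: "(\<lambda>n. ?D n / (real n * \<bar>?A n\<bar>)) \<longlonglongrightarrow> 0"
  proof (rule real_tendsto_sandwich)
    show "\<forall>\<^sub>F n in sequentially. 0 \<le> ?D n / (real n * \<bar>?A n\<bar>)" by (simp add: D0)
    show "\<forall>\<^sub>F n in sequentially. ?D n / (real n * \<bar>?A n\<bar>) \<le> 8 * (?b n / \<bar>?A n\<bar>)"
      using eventually_gt_at_top[of 0]
    proof eventually_elim
      case (elim n)
      have "?D n / (real n * \<bar>?A n\<bar>) \<le> 8 * (real n * ?b n) / (real n * \<bar>?A n\<bar>)"
        by (intro divide_right_mono dev) auto
      thus ?case using elim by simp
    qed
    show "(\<lambda>n. 8 * (?b n / \<bar>?A n\<bar>)) \<longlonglongrightarrow> 0" using tendsto_mult_right_zero[OF ratio_b] .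
  qed simp
  have "(\<lambda>n. ?W n / (real n * \<bar>?A n\<bar>) - 1) \<longlonglongrightarrow> 0"
  proof (rule Lim_null_comparison[OF _ D_A])
    show "\<forall>\<^sub>F n in sequentially. norm (?W n / (real n * \<bar>?A n\<bar>) - 1) \<le> ?D n / (real n * \<bar>?A n\<bar>)"
      using A0 eventually_gt_at_top[of 0]
    proof eventually_elim
      case (elim n)
      have "?W n / (real n * \<bar>?A n\<bar>) - 1 = (?W n - real n * \<bar>?A n\<bar>) / (real n * \<bar>?A n\<bar>)"
        using elim by (simp add: field_simps)
      hence "norm (?W n / (real n * \<bar>?A n\<bar>) - 1) = \<bar>?W n - real n * \<bar>?A n\<bar>\<bar> / (real n * \<bar>?A n\<bar>)"
        by (simp add: abs_mult)
      thus ?case using weight_sum_deviation[of g n ?A] by (simp add: divide_right_mono)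
    qed
  qed
  hence "(\<lambda>n. ?W n / (real n * \<bar>?A n\<bar>)) \<longlonglongrightarrow> 1" by (simp add: LIM_zero_iff)
  from tendsto_inverse[OF this] have W_A: "(\<lambda>n. real n * \<bar>?A n\<bar> / ?W n) \<longlonglongrightarrow> 1"
    by (simp add: inverse_eq_divide)
  \<comment> \<open>The sign of \<open>pp_mean g n\<close> must settle for the signed quotient to converge.\<close>
  have "\<forall>\<^sub>F n in sequentially. ?b (Suc n) \<le> \<bar>?A (Suc n)\<bar> / 16 \<and> ?A (Suc n) \<noteq> 0"
    using eventually_conj[OF b16 A0] by (rule eventually_sequentially_Suc[THEN iffD2])
  hence "\<forall>\<^sub>F n in sequentially. ?A (Suc n) \<noteq> 0 \<and> \<bar>?A (Suc n) - ?A n\<bar> \<le> \<bar>?A (Suc n)\<bar> / 2"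
  proof eventually_elim
    case (elim n)
    thus ?case using order.trans[OF pp_mean_Suc_diff[of g n] conjunct1[OF elim]] by (intro conjI) (blast, linarith)
  qed
  then obtain s where s: "\<forall>\<^sub>F n in sequentially. sgn (?A n) = s"
    using eventually_constant_sign by blast
  have "(\<lambda>n. s * (real n * \<bar>?A n\<bar> / ?W n)) \<longlonglongrightarrow> s * 1"
    by (intro tendsto_mult tendsto_const W_A)
  moreover have "\<forall>\<^sub>F n in sequentially. s * (real n * \<bar>?A n\<bar> / ?W n) = real n * ?A n / ?W n"
    using s
  proof eventually_elim
    case (elim n)
    have "?A n = sgn (?A n) * \<bar>?A n\<bar>" by (simp add: sgn_mult_abs)
    thus ?case using elim by (simp add: mult_ac)
  qed
  ultimately have "(\<lambda>n. real n * ?A n / ?W n) \<longlonglongrightarrow> s * 1" by (rule Lim_transform_eventually)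
  hence mean: "convergent (\<lambda>n. real n * ?A n / ?W n)" by (rule convergentI)
  have "(\<lambda>n. ?D n / (real n * \<bar>?A n\<bar>) * (real n * \<bar>?A n\<bar> / ?W n)) \<longlonglongrightarrow> 0 * 1"
    by (intro tendsto_mult D_A W_A)
  moreover have "\<forall>\<^sub>F n in sequentially. ?D n / (real n * \<bar>?A n\<bar>) * (real n * \<bar>?A n\<bar> / ?W n) = ?D n / ?W n"
    using A0 eventually_gt_at_top[of 0] by eventually_elim auto
  ultimately have "(\<lambda>n. ?D n / ?W n) \<longlonglongrightarrow> 0 * 1" by (rule Lim_transform_eventually)
  hence dev0: "(\<lambda>n. ?D n / ?W n) \<longlonglongrightarrow> 0" by simp
  have "filterlim (\<lambda>n. 8 * \<delta> * real n) at_top sequentially"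
    using \<delta>(1) by (intro filterlim_tendsto_pos_mult_at_top[OF tendsto_const _ filterlim_real_sequentially]) auto
  moreover have "\<forall>\<^sub>F n in sequentially. 8 * \<delta> * real n \<le> ?W n"
    using Wge b16 \<delta>(2)
  proof eventually_elim
    case (elim n)
    have "8 * \<delta> * real n \<le> \<bar>?A n\<bar> / 2 * real n" using elim by (intro mult_right_mono) auto
    also have "\<dots> = real n * \<bar>?A n\<bar> / 2" by simp
    also have "\<dots> \<le> ?W n" by (rule elim(1))
    finally show ?case .
  qed
  ultimately have "filterlim ?W at_top sequentially" by (rule filterlim_at_top_mono)
  thus ?thesis using mean dev0 by (simp add: concentrated_weight_def admissible_weight_def)
qed

text \<open>
  A reverse Hoelder inequality: the quadratic mean of a concentrated weight is comparable to its
  mean absolute value. Convergent sequences are bounded, so it holds for all \<open>n\<close> with one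
  constant; when \<open>weight_sum w n = 0\<close> both sides vanish.
\<close>

lemma concentrated_weight_second_moment:
  assumes "concentrated_weight w c"
  shows "\<exists>K>0. \<forall>n. sqrt (real n * (\<Sum>k=1..n. (w k)\<^sup>2)) \<le> K * weight_sum w n"
proof -
  let ?W = "weight_sum w"
  have W0: "0 \<le> ?W n" for n by (simp add: weight_sum_def sum_nonneg)
  have "Bseq (\<lambda>n. real n * c n / ?W n)"
    using assms unfolding concentrated_weight_def by (blast intro: convergent_imp_Bseq)
  then obtain K1 where K1: "K1 > 0" "\<forall>n. norm (real n * c n / ?W n) \<le> K1" by (rule BseqE)
  have "Bseq (\<lambda>n. deviation w c n / ?W n)"
    using assms unfolding concentrated_weight_def by (blast intro: convergent_imp_Bseq convergentI)
  then obtain K2 where K2: "K2 > 0" "\<forall>n. norm (deviation w c n / ?W n) \<le> K2" by (rule BseqE)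
  have "sqrt (real n * (\<Sum>k=1..n. (w k)\<^sup>2)) \<le> 2 * (K1 + K2) * ?W n" for n
  proof (cases "?W n = 0")
    case True
    hence "\<forall>k\<in>{1..n}. \<bar>w k\<bar> = 0" unfolding weight_sum_def by (subst (asm) sum_nonneg_eq_0_iff) auto
    hence "(\<Sum>k=1..n. (w k)\<^sup>2) = 0" by (intro sum.neutral) simp
    thus ?thesis using True by simp
  next
    case False
    hence pos: "?W n > 0" using W0[of n] by simp
    have 1: "\<bar>real n * c n\<bar> \<le> K1 * ?W n" using K1(2)[rule_format, of n] pos by (simp add: field_simps abs_mult)
    have dev0: "deviation w c n \<ge> 0" unfolding deviation_def by (simp add: sum_nonneg)
    have 2: "deviation w c n \<le> K2 * ?W n" using K2(2)[rule_format, of n] pos dev0 by (simp add: field_simps)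
    have dev2: "(deviation w c n)\<^sup>2 = real n * (\<Sum>k=1..n. (w k - c n)\<^sup>2)"
      unfolding deviation_def by (simp add: sum_nonneg)
    have "(\<Sum>k=1..n. (w k)\<^sup>2) \<le> (\<Sum>k=1..n. 2 * (w k - c n)\<^sup>2 + 2 * (c n)\<^sup>2)"
    proof (intro sum_mono)
      fix k
      have "2 * (w k - c n)\<^sup>2 + 2 * (c n)\<^sup>2 - (w k)\<^sup>2 = (w k - 2 * c n)\<^sup>2"
        by (simp add: power2_eq_square algebra_simps)
      thus "(w k)\<^sup>2 \<le> 2 * (w k - c n)\<^sup>2 + 2 * (c n)\<^sup>2" by (smt (verit) zero_le_power2)
    qed
    also have "\<dots> = 2 * (\<Sum>k=1..n. (w k - c n)\<^sup>2) + 2 * (real n * (c n)\<^sup>2)"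
      by (simp add: sum.distrib sum_distrib_left)
    finally have "real n * (\<Sum>k=1..n. (w k)\<^sup>2) \<le> real n * (2 * (\<Sum>k=1..n. (w k - c n)\<^sup>2) + 2 * (real n * (c n)\<^sup>2))"
      by (intro mult_left_mono) auto
    also have "\<dots> = 2 * (deviation w c n)\<^sup>2 + 2 * \<bar>real n * c n\<bar>\<^sup>2"
      unfolding dev2 by (simp add: power2_eq_square algebra_simps)
    also have "\<dots> \<le> 2 * (K2 * ?W n)\<^sup>2 + 2 * (K1 * ?W n)\<^sup>2"
      using 1 2 dev0 by (intro add_mono mult_left_mono power_mono) auto
    also have "\<dots> \<le> (2 * (K1 + K2) * ?W n)\<^sup>2"
    proof -
      have "0 \<le> 2 * (K1 * ?W n)\<^sup>2 + 2 * (K2 * ?W n)\<^sup>2 + 8 * ((K1 * ?W n) * (K2 * ?W n))"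
        using K1(1) K2(1) pos by (intro add_nonneg_nonneg mult_nonneg_nonneg) auto
      thus ?thesis by (simp add: power2_eq_square algebra_simps)
    qed
    finally show ?thesis using K1(1) K2(1) pos by (intro real_le_lsqrt) (auto simp: sum_nonneg)
  qed
  thus ?thesis using K1(1) K2(1) by (intro exI[of _ "2 * (K1 + K2)"]) auto
qed

section \<open>The maximal ergodic theorem and Birkhoff's theorem\<close>

locale preserving_system =
  fixes M :: "'a measure" and \<tau> :: "'a \<Rightarrow> 'a"
  assumes system: "dynamical_system M \<tau>"
begin

sublocale prob_space M
  using system by (simp add: dynamical_system_def)

lemma measurable_step [measurable]: "\<tau> \<in> M \<rightarrow>\<^sub>M M"
  using system by (simp add: dynamical_system_def)

lemma distr_step: "distr M M \<tau> = M"
  using system by (simp add: dynamical_system_def)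

lemma step_in_space: "x \<in> space M \<Longrightarrow> \<tau> x \<in> space M"
  using measurable_step by (rule measurable_space)

lemma integrable_step:
  fixes f :: "'a \<Rightarrow> real"
  assumes "integrable M f"
  shows "integrable M (\<lambda>x. f (\<tau> x))" "(\<integral>x. f (\<tau> x) \<partial>M) = (\<integral>x. f x \<partial>M)"
  using integrable_distr[of \<tau> M M f] integral_distr[of \<tau> M M f] assms by (simp_all add: distr_step)

definition orbit_sum :: "('a \<Rightarrow> real) \<Rightarrow> nat \<Rightarrow> 'a \<Rightarrow> real" where
  "orbit_sum f n x = (\<Sum>k<n. f ((\<tau> ^^ k) x))"

lemma orbit_sum_0 [simp]: "orbit_sum f 0 x = 0"
  by (simp add: orbit_sum_def)

lemma orbit_sum_Suc: "orbit_sum f (Suc n) x = f x + orbit_sum f n (\<tau> x)"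
  unfolding orbit_sum_def by (subst sum.lessThan_Suc_shift) (simp add: funpow_swap1)

lemma orbit_sum_measurable [measurable]:
  assumes [measurable]: "f \<in> borel_measurable M"
  shows "orbit_sum f n \<in> borel_measurable M"
  unfolding orbit_sum_def[abs_def] by measurable

text \<open>
  The maximum of \<open>orbit_sum f n x\<close> over \<open>n \<le> N\<close>. Peeling off the first point of the orbit
  instead of the last makes the relation between its values at \<open>x\<close> and at \<open>\<tau> x\<close>, the core of the maximal
  ergodic theorem, the defining equation.
\<close>

primrec running_max :: "('a \<Rightarrow> real) \<Rightarrow> nat \<Rightarrow> 'a \<Rightarrow> real" where
  "running_max f 0 x = 0"
| "running_max f (Suc N) x = max 0 (f x + running_max f N (\<tau> x))"

lemma running_max_nonneg: "0 \<le> running_max f N x"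
  by (cases N) auto

lemma running_max_mono_Suc: "running_max f N x \<le> running_max f (Suc N) x"
proof (induction N arbitrary: x)
  case (Suc N)
  from Suc[of "\<tau> x"] show ?case by simp
qed simp

lemma running_max_pos_iff: "0 < running_max f N x \<longleftrightarrow> (\<exists>n\<le>N. 0 < orbit_sum f n x)"
proof
  have "\<exists>n\<le>N. running_max f N x = orbit_sum f n x"
  proof (induction N arbitrary: x)
    case (Suc N)
    obtain n where "n \<le> N" "running_max f N (\<tau> x) = orbit_sum f n (\<tau> x)" using Suc by blast
    thus ?case
      by (cases "0 \<le> f x + running_max f N (\<tau> x)")
        (auto simp: orbit_sum_Suc intro: exI[of _ "Suc n"] exI[of _ 0])
  qed simp
  thus "0 < running_max f N x \<Longrightarrow> \<exists>n\<le>N. 0 < orbit_sum f n x" by metis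
  have "orbit_sum f n x \<le> running_max f N x" if "n \<le> N" for n
    using that
  proof (induction N arbitrary: n x)
    case (Suc N)
    show ?case
    proof (cases n)
      case (Suc m)
      thus ?thesis using Suc.IH[of m "\<tau> x"] Suc.prems by (simp add: orbit_sum_Suc)
    qed (simp add: running_max_nonneg)
  qed simp
  thus "\<exists>n\<le>N. 0 < orbit_sum f n x \<Longrightarrow> 0 < running_max f N x" by fastforce
qed

lemma running_max_integrable: "integrable M f \<Longrightarrow> integrable M (running_max f N)"
proof (induction N)
  case (Suc N)
  have "integrable M (\<lambda>x. running_max f N (\<tau> x))" by (rule integrable_step) (use Suc in auto)
  hence "integrable M (\<lambda>x. max 0 (f x + running_max f N (\<tau> x)))" using Suc.prems by auto
  thus ?case by (simp cong: Bochner_Integration.integrable_cong)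
next
  case 0
  show ?case by (simp cong: Bochner_Integration.integrable_cong)
qed

text \<open>
  Garsia's argument. Where the running maximum \<open>m\<close> is positive, \<open>f x \<ge> m x - m (\<tau> x)\<close>; elsewhere
  \<open>m x - m (\<tau> x) \<le> 0\<close>. So \<open>f\<close>, restricted to the positivity set of \<open>m\<close>, dominates \<open>m - m \<circ> \<tau>\<close>,
  whose integral is zero because \<open>\<tau>\<close> preserves the measure. The sets increase to the set in the statement.
\<close>

theorem maximal_ergodic:
  assumes f: "integrable M f"
  shows "0 \<le> (\<integral>x. f x * indicator {x \<in> space M. \<exists>n. 0 < orbit_sum f n x} x \<partial>M)"
proof -
  have [measurable]: "f \<in> borel_measurable M" using f by simp
  have [measurable]: "running_max f N \<in> borel_measurable M" for N
    using running_max_integrable[OF f] by simp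
  define P where "P N = {x \<in> space M. 0 < running_max f (Suc N) x}" for N
  have [measurable]: "P N \<in> sets M" for N unfolding P_def by measurable
  let ?E = "{x \<in> space M. \<exists>n. 0 < orbit_sum f n x}"
  have finite_stage: "0 \<le> (\<integral>x. f x * indicator (P N) x \<partial>M)" for N
  proof -
    let ?m = "running_max f (Suc N)"
    have i: "integrable M ?m" by (rule running_max_integrable[OF f])
    have "0 = (\<integral>x. ?m x - ?m (\<tau> x) \<partial>M)"
      using Bochner_Integration.integral_diff[OF i integrable_step(1)[OF i]] integrable_step(2)[OF i]
      by (simp only: diff_self)
    also have "\<dots> \<le> (\<integral>x. f x * indicator (P N) x \<partial>M)"
    proof (rule integral_mono)
      show "integrable M (\<lambda>x. ?m x - ?m (\<tau> x))"
        by (rule Bochner_Integration.integrable_diff[OF i integrable_step(1)[OF i]])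
      show "integrable M (\<lambda>x. f x * indicator (P N) x)"
        using integrable_mult_indicator[OF _ f, of "P N"] by (simp add: mult.commute)
      fix x assume x: "x \<in> space M"
      show "?m x - ?m (\<tau> x) \<le> f x * indicator (P N) x"
      proof (cases "0 < ?m x")
        case True
        hence "?m x = f x + running_max f N (\<tau> x)" by simp
        thus ?thesis using True x running_max_mono_Suc[of f N "\<tau> x"] by (simp add: P_def)
      next
        case False
        thus ?thesis using running_max_nonneg[of f "Suc N" "\<tau> x"] by (simp add: P_def)
      qed
    qed
    finally show ?thesis .
  qed
  have "(\<lambda>N. \<integral>x. f x * indicator (P N) x \<partial>M) \<longlonglongrightarrow> (\<integral>x. f x * indicator ?E x \<partial>M)"
  proof (rule integral_dominated_convergence[where w = "\<lambda>x. \<bar>f x\<bar>"])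
    show "AE x in M. (\<lambda>N. f x * indicator (P N) x) \<longlonglongrightarrow> f x * indicator ?E x"
    proof (rule AE_I2)
      fix x assume x: "x \<in> space M"
      show "(\<lambda>N. f x * indicator (P N) x) \<longlonglongrightarrow> f x * indicator ?E x"
      proof (cases "x \<in> ?E")
        case True
        then obtain n where n: "0 < orbit_sum f n x" by blast
        have "x \<in> P N" if "N \<ge> n" for N
          using running_max_pos_iff[of f "Suc N" x] n that x by (auto simp: P_def simp del: running_max.simps)
        hence "eventually (\<lambda>N. f x * indicator (P N) x = f x * indicator ?E x) sequentially"
          using True unfolding eventually_sequentially by (intro exI[of _ n]) simp
        thus ?thesis by (rule tendsto_eventually)
      next
        case False
        hence "x \<notin> P N" for N
          using running_max_pos_iff[of f "Suc N" x] x by (auto simp: P_def simp del: running_max.simps)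
        thus ?thesis using False by simp
      qed
    qed
  qed (use f in \<open>auto simp: indicator_def abs_mult\<close>)
  thus ?thesis using finite_stage by (intro LIMSEQ_le_const) auto
qed

text \<open>
  Equivalent to \<open>b < limsup (orbit_sum f n x / n)\<close>. The margin \<open>1 / Suc j\<close> absorbs the bounded change
  of the sums when the orbit is shifted by one step, which makes the property invariant, and
  choosing it from a countable set makes the property measurable.
\<close>

definition exceeds :: "('a \<Rightarrow> real) \<Rightarrow> real \<Rightarrow> 'a \<Rightarrow> bool" where
  "exceeds f b x \<longleftrightarrow> (\<exists>j::nat. \<forall>m. \<exists>n\<ge>m. (b + 1 / real (Suc j)) * real n < orbit_sum f n x)"

lemma exceeds_measurable [measurable]:
  assumes [measurable]: "f \<in> borel_measurable M"
  shows "Measurable.pred M (exceeds f b)"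
  unfolding exceeds_def[abs_def] by measurable

lemma exceedsI:
  assumes "b < c" "\<exists>\<^sub>F n in sequentially. c < orbit_sum f n x / real n"
  shows "exceeds f b x"
proof -
  obtain j where j: "1 / real (Suc j) < c - b"
    using assms(1) nat_approx_posE[of "c - b"] by auto
  have "\<exists>n\<ge>m. (b + 1 / real (Suc j)) * real n < orbit_sum f n x" for m
  proof -
    obtain n where n: "n \<ge> Suc m" "c < orbit_sum f n x / real n"
      using assms(2) unfolding frequently_sequentially by blast
    have "(b + 1 / real (Suc j)) * real n \<le> c * real n"
      using j by (intro mult_right_mono) auto
    also have "\<dots> < orbit_sum f n x" using n by (simp add: field_simps)
    finally show ?thesis using n by (intro exI[of _ n]) auto
  qed
  thus ?thesis unfolding exceeds_def by blast
qed

text \<open>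
  Shifting the index by at most one and the values by at most \<open>K\<close> costs half of the margin, which
  \<open>n\<close> times this half outweighs for large \<open>n\<close>.
\<close>

lemma frequently_above_perturb:
  fixes u v :: "nat \<Rightarrow> real"
  assumes above: "\<forall>m. \<exists>n\<ge>m. (b + 1 / real (Suc j)) * real n < u n"
    and close: "\<And>n. n \<ge> 1 \<Longrightarrow> \<bar>v (s n) - u n\<bar> \<le> K" and s: "\<And>n. n \<ge> 1 \<Longrightarrow> \<bar>real (s n) - real n\<bar> \<le> 1"
  shows "\<exists>j. \<forall>m. \<exists>n\<ge>m. (b + 1 / real (Suc j)) * real n < v n"
proof (rule exI[of _ "2 * j + 1"], rule allI)
  fix m
  define e where "e = 1 / real (Suc (2 * j + 1))"
  have e: "e > 0" "1 / real (Suc j) = 2 * e" by (simp_all add: e_def field_simps)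
  obtain L where L: "real L \<ge> (K + \<bar>b + e\<bar>) / e" using real_arch_simple by blast
  obtain n where n: "n \<ge> max (m + 1) L" "(b + 2 * e) * real n < u n"
    using above[rule_format, of "max (m + 1) L"] unfolding e(2) by blast
  have n1: "n \<ge> 1" using n by simp
  have "(K + \<bar>b + e\<bar>) / e \<le> real n" using L n by simp
  hence 1: "K + \<bar>b + e\<bar> \<le> e * real n" using e by (simp add: field_simps)
  have "\<bar>b + e\<bar> * \<bar>real (s n) - real n\<bar> \<le> \<bar>b + e\<bar> * 1"
    using s[OF n1] by (intro mult_left_mono) auto
  hence "(b + e) * (real (s n) - real n) \<le> \<bar>b + e\<bar>"
    using abs_ge_self[of "(b + e) * (real (s n) - real n)"] unfolding abs_mult mult_1_right
    by (rule order.trans[rotated])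
  hence "(b + e) * real (s n) \<le> (b + e) * real n + \<bar>b + e\<bar>"
    unfolding right_diff_distrib by linarith
  also have "\<dots> \<le> (b + 2 * e) * real n - K" using 1 unfolding distrib_right by linarith
  also have "\<dots> < v (s n)" using n close[OF n1] by linarith
  finally have "(b + e) * real (s n) < v (s n)" .
  moreover have "s n \<ge> m" using s[OF n1] n by linarith
  ultimately show "\<exists>n\<ge>m. (b + 1 / real (Suc (2 * j + 1))) * real n < v n" unfolding e_def by blast
qed

lemma exceeds_step: "exceeds f b (\<tau> x) \<longleftrightarrow> exceeds f b x"
proof
  assume "exceeds f b (\<tau> x)"
  then obtain j where "\<forall>m. \<exists>n\<ge>m. (b + 1 / real (Suc j)) * real n < orbit_sum f n (\<tau> x)"
    unfolding exceeds_def by blast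
  from frequently_above_perturb[OF this, where s = Suc and K = "\<bar>f x\<bar>" and v = "\<lambda>n. orbit_sum f n x"]
  show "exceeds f b x" unfolding exceeds_def by (simp add: orbit_sum_Suc)
next
  assume "exceeds f b x"
  then obtain j where "\<forall>m. \<exists>n\<ge>m. (b + 1 / real (Suc j)) * real n < orbit_sum f n x"
    unfolding exceeds_def by blast
  moreover have "\<bar>orbit_sum f (n - 1) (\<tau> x) - orbit_sum f n x\<bar> \<le> \<bar>f x\<bar>" if "n \<ge> 1" for n
    using that by (cases n) (simp_all add: orbit_sum_Suc)
  moreover have "\<bar>real (n - 1) - real n\<bar> \<le> 1" if "n \<ge> 1" for n using that by (simp add: of_nat_diff)
  ultimately have "\<exists>j. \<forall>m. \<exists>n\<ge>m. (b + 1 / real (Suc j)) * real n < orbit_sum f n (\<tau> x)"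
    by (rule frequently_above_perturb[where s = "\<lambda>n. n - 1"])
  thus "exceeds f b (\<tau> x)" unfolding exceeds_def .
qed

text \<open>
  The maximal ergodic theorem for \<open>(f - b)\<close> cut down to \<open>A\<close>. Since \<open>A\<close> is invariant, an orbit stays
  in \<open>A\<close> or outside it, so the set on which some orbit sum is positive is \<open>A\<close> itself.
\<close>

lemma invariant_set_bound:
  assumes f: "integrable M f" and A: "A \<in> sets M"
    and inv: "\<And>x. x \<in> space M \<Longrightarrow> \<tau> x \<in> A \<longleftrightarrow> x \<in> A"
    and ex: "\<And>x. x \<in> A \<Longrightarrow> exceeds f b x"
  shows "b * prob A \<le> (\<integral>x. f x * indicator A x \<partial>M)"
proof -
  define h where "h x = (f x - b) * indicator A x" for x
  have fi: "integrable M (\<lambda>x. f x * indicator A x)"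
    using integrable_mult_indicator[OF A f] by (simp add: mult.commute)
  have bi: "integrable M (\<lambda>x. b * indicator A x)" using A by (simp add: less_top[symmetric])
  have h: "integrable M h" unfolding h_def left_diff_distrib using fi bi by (rule Bochner_Integration.integrable_diff)
  have sum_h: "orbit_sum h n x = indicator A x * (orbit_sum f n x - b * real n)" if "x \<in> space M" for n x
    using that
  proof (induction n arbitrary: x)
    case (Suc n)
    have "indicator A (\<tau> x) = (indicator A x :: real)" using inv[OF Suc.prems] by (simp add: indicator_def)
    thus ?case using Suc.IH[OF step_in_space[OF Suc.prems]]
      by (simp add: orbit_sum_Suc h_def algebra_simps)
  qed simp
  have "{x \<in> space M. \<exists>n. 0 < orbit_sum h n x} = A"
  proof (intro equalityI subsetI)
    fix x assume "x \<in> {x \<in> space M. \<exists>n. 0 < orbit_sum h n x}"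
    then obtain n where "x \<in> space M" "0 < orbit_sum h n x" by blast
    thus "x \<in> A" using sum_h[of x n] by (cases "x \<in> A") auto
  next
    fix x assume x: "x \<in> A"
    hence xs: "x \<in> space M" using A sets.sets_into_space by blast
    obtain j n where jn: "(b + 1 / real (Suc j)) * real n < orbit_sum f n x"
      using ex[OF x] unfolding exceeds_def by blast
    have "b * real n \<le> (b + 1 / real (Suc j)) * real n" by (intro mult_right_mono) auto
    hence "b * real n < orbit_sum f n x" using jn by linarith
    hence "0 < orbit_sum h n x" using sum_h[OF xs, of n] x by simp
    thus "x \<in> {x \<in> space M. \<exists>n. 0 < orbit_sum h n x}" using xs by blast
  qed
  hence "0 \<le> (\<integral>x. h x * indicator A x \<partial>M)" using maximal_ergodic[OF h] by simp
  also have "(\<lambda>x. h x * indicator A x) = (\<lambda>x. f x * indicator A x - b * indicator A x)"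
    by (auto simp: h_def indicator_def)
  also have "(\<integral>x. f x * indicator A x - b * indicator A x \<partial>M) = (\<integral>x. f x * indicator A x \<partial>M) - b * prob A"
    using fi bi A by (simp add: sets.sets_into_space Int_absorb1)
  finally show ?thesis by simp
qed

text \<open>
  The upper limit of the averages is finite: on the invariant set where it is infinite, the
  integral of \<open>f\<close> would be at least \<open>i\<close> times the measure of the set, for every \<open>i\<close>.
\<close>

lemma AE_not_always_exceeds:
  assumes f: "integrable M f"
  shows "AE x in M. \<exists>i::nat. \<not> exceeds f (real i) x"
proof -
  have [measurable]: "f \<in> borel_measurable M" using f by simp
  define A where "A = {x \<in> space M. \<forall>i::nat. exceeds f (real i) x}"
  have A: "A \<in> sets M" unfolding A_def by measurable
  have "real i * prob A \<le> (\<integral>x. f x * indicator A x \<partial>M)" for i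
    by (rule invariant_set_bound[OF f A]) (auto simp: A_def exceeds_step step_in_space)
  moreover have "prob A = 0 \<or> (\<exists>i. (\<integral>x. f x * indicator A x \<partial>M) < real i * prob A)"
    using reals_Archimedean3[of "prob A"] by (metis less_eq_real_def measure_nonneg)
  ultimately have "prob A = 0" by (meson not_le)
  hence "A \<in> null_sets M" using A by (simp add: emeasure_eq_measure null_setsI)
  thus ?thesis by (rule AE_I') (auto simp: A_def)
qed

text \<open>
  On the invariant set where the lower limit is below \<open>a\<close> and the upper limit above \<open>b\<close>, the mean of
  \<open>f\<close> would be at most \<open>a\<close> and at least \<open>b\<close>.
\<close>

lemma AE_no_oscillation:
  assumes f: "integrable M f" and ab: "a < b"
  shows "AE x in M. \<not> (exceeds f b x \<and> exceeds (\<lambda>x. - f x) (- a) x)"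
proof -
  have [measurable]: "f \<in> borel_measurable M" using f by simp
  define A where "A = {x \<in> space M. exceeds f b x \<and> exceeds (\<lambda>x. - f x) (- a) x}"
  have A: "A \<in> sets M" unfolding A_def by measurable
  have "b * prob A \<le> (\<integral>x. f x * indicator A x \<partial>M)"
    by (rule invariant_set_bound[OF f A]) (auto simp: A_def exceeds_step step_in_space)
  moreover have "- a * prob A \<le> (\<integral>x. - f x * indicator A x \<partial>M)"
    by (rule invariant_set_bound) (use f A in \<open>auto simp: A_def exceeds_step step_in_space\<close>)
  ultimately have "(b - a) * prob A \<le> 0" by (simp add: algebra_simps)
  hence "prob A = 0" using ab by (simp add: mult_le_0_iff measure_le_0_iff)
  hence "A \<in> null_sets M" using A by (simp add: emeasure_eq_measure null_setsI)
  thus ?thesis by (rule AE_I') (auto simp: A_def)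
qed

theorem birkhoff_ergodic_real:
  assumes f: "integrable M f"
  shows "AE x in M. convergent (\<lambda>n. orbit_sum f n x / real n)"
proof -
  have "AE x in M. \<forall>a\<in>\<rat>. \<forall>b\<in>\<rat>. a < b \<longrightarrow> \<not> (exceeds f b x \<and> exceeds (\<lambda>x. - f x) (- a) x)"
    using AE_no_oscillation[OF f] by (simp add: AE_ball_countable countable_rat)
  moreover have "AE x in M. \<exists>i::nat. \<not> exceeds f (real i) x" by (rule AE_not_always_exceeds[OF f])
  moreover have "AE x in M. \<exists>i::nat. \<not> exceeds (\<lambda>x. - f x) (real i) x"
    by (rule AE_not_always_exceeds) (use f in auto)
  ultimately show ?thesis
  proof eventually_elim
    case (elim x)
    define u where "u n = orbit_sum f n x / real n" for n
    have neg: "orbit_sum (\<lambda>x. - f x) n x / real n = - u n" for n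
      by (simp add: u_def orbit_sum_def sum_negf)
    let ?L = "limsup (\<lambda>n. ereal (u n))" and ?l = "liminf (\<lambda>n. ereal (u n))"
    have hi: "exceeds f b x" if "b < c" "ereal c < ?L" for b c
    proof (rule exceedsI[OF that(1)])
      show "\<exists>\<^sub>F n in sequentially. c < orbit_sum f n x / real n"
        using Limsup_bounded[of "\<lambda>n. ereal (u n)" "ereal c" sequentially] that(2)
        by (auto simp: u_def frequently_def not_less)
    qed
    have lo: "exceeds (\<lambda>x. - f x) (- a) x" if "c < a" "?l < ereal c" for a c
    proof (rule exceedsI[of "- a" "- c"])
      show "\<exists>\<^sub>F n in sequentially. - c < orbit_sum (\<lambda>x. - f x) n x / real n"
        unfolding neg using Liminf_bounded[of "ereal c" "\<lambda>n. ereal (u n)" sequentially] that(2)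
        by (auto simp: frequently_def not_less)
    qed (use that in simp)
    have le: "?l \<le> ?L" by (intro Liminf_le_Limsup) simp
    have "?L \<noteq> \<infinity>"
    proof
      assume "?L = \<infinity>"
      hence "exceeds f b x" for b using hi[of b "b + 1"] by simp
      thus False using elim by blast
    qed
    moreover have "?l \<noteq> - \<infinity>"
    proof
      assume "?l = - \<infinity>"
      hence "exceeds (\<lambda>x. - f x) b x" for b using lo[of "- b - 1" "- b"] by simp
      thus False using elim by blast
    qed
    moreover have "\<not> ?l < ?L"
    proof
      assume lt: "?l < ?L"
      \<comment> \<open>Four numbers \<open>c < a < b < d\<close> between the limits: the rational \<open>a, b\<close> index the null sets, and
        the outer gaps supply the margins that \<open>exceeds\<close> demands.\<close>
      obtain c where c: "?l < ereal c" "ereal c < ?L" using ereal_dense2[OF lt] by blast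
      obtain d where d: "ereal c < ereal d" "ereal d < ?L" using ereal_dense2[OF c(2)] by blast
      obtain a where a: "a \<in> \<rat>" "c < a" "a < d" using Rats_dense_in_real[of c d] d by auto
      obtain b where b: "b \<in> \<rat>" "a < b" "b < d" using Rats_dense_in_real[of a d] a by auto
      show False using elim(1) a b hi[of b d] lo[of c a] c d by blast
    qed
    ultimately obtain r where r: "?L = ereal r" "?l = ereal r"
      using le by (cases ?L; cases ?l) auto
    have "(\<lambda>n. ereal (u n)) \<longlonglongrightarrow> ereal r"
      by (rule Liminf_eq_Limsup) (use r in auto)
    thus ?case unfolding u_def by (auto simp: convergent_def)
  qed
qed

end

section \<open>The dominated ergodic theorem\<close>

lemma ennreal_powr_ennreal: "0 \<le> a \<Longrightarrow> ennreal_powr (ennreal a) p = ennreal (a powr p)"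
  by (simp add: ennreal_powr_def)

lemma ennreal_powr_mono: "x \<le> y \<Longrightarrow> 0 \<le> p \<Longrightarrow> ennreal_powr x p \<le> ennreal_powr y p"
  by (cases x; cases y) (auto simp: ennreal_powr_def ennreal_leI powr_mono2 top_unique)

lemma ennreal_powr_mult:
  assumes "0 < C"
  shows "ennreal_powr (ennreal C * x) p = ennreal (C powr p) * ennreal_powr x p"
proof (cases x)
  case (real r)
  thus ?thesis using assms
    by (simp add: ennreal_powr_ennreal powr_mult flip: ennreal_mult)
next
  case top
  thus ?thesis using assms by (simp add: ennreal_powr_def ennreal_mult_top)
qed

lemma ennreal_powr_measurable [measurable (raw)]:
  assumes [measurable]: "h \<in> borel_measurable M"
  shows "(\<lambda>x. ennreal_powr (h x) p) \<in> borel_measurable M"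
  unfolding ennreal_powr_def by measurable

lemma nn_integral_powr_Ioo:
  assumes "a > -1" "0 \<le> c"
  shows "(\<integral>\<^sup>+t. ennreal (t powr a) * of_bool (0 < t \<and> t < c) \<partial>lborel) = ennreal (c powr (a + 1) / (a + 1))"
proof -
  have "((\<lambda>t. t powr a) has_integral (c powr (a + 1) / (a + 1))) {0<..<c}"
    using has_integral_powr_from_0[OF assms] by (simp add: has_integral_Icc_iff_Ioo)
  hence "((\<lambda>t. indicator {0<..<c} t * t powr a) has_integral (c powr (a + 1) / (a + 1))) UNIV"
    by (subst (asm) has_integral_restrict_UNIV[symmetric])
       (erule has_integral_eq[rotated], simp add: indicator_def)
  hence "(\<integral>\<^sup>+t. ennreal (indicator {0<..<c} t * t powr a) \<partial>lborel) = ennreal (c powr (a + 1) / (a + 1))"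
    by (intro nn_integral_has_integral_lborel) auto
  moreover have "ennreal (indicator {0<..<c} t * t powr a) = ennreal (t powr a) * of_bool (0 < t \<and> t < c)" for t
    by (simp add: indicator_def)
  ultimately show ?thesis by simp
qed

text \<open>
  Maximal functions may take the infinite value; there both sides are infinite, because the
  integral dominates the one for every finite \<open>y\<close>.
\<close>

lemma ennreal_powr_layer_cake:
  assumes r: "r > 0"
  shows "ennreal_powr y r = (\<integral>\<^sup>+t. ennreal (r * t powr (r - 1)) * of_bool (0 < t \<and> ennreal t < y) \<partial>lborel)"
proof -
  have *: "(\<integral>\<^sup>+t. ennreal (r * t powr (r - 1)) * of_bool (0 < t \<and> ennreal t < ennreal c) \<partial>lborel) = ennreal (c powr r)"
    if "c \<ge> 0" for c
  proof -
    have "(\<integral>\<^sup>+t. ennreal (r * t powr (r - 1)) * of_bool (0 < t \<and> ennreal t < ennreal c) \<partial>lborel)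
       = (\<integral>\<^sup>+t. ennreal r * (ennreal (t powr (r - 1)) * of_bool (0 < t \<and> t < c)) \<partial>lborel)"
      using r that by (intro nn_integral_cong) (auto simp: indicator_def ennreal_mult ennreal_less_iff)
    also have "\<dots> = ennreal r * ennreal (c powr (r - 1 + 1) / (r - 1 + 1))"
      using nn_integral_powr_Ioo[of "r - 1" c] r that by (subst nn_integral_cmult) auto
    also have "\<dots> = ennreal (c powr r)" using r by (simp flip: ennreal_mult)
    finally show ?thesis .
  qed
  show ?thesis
  proof (cases y)
    case (real c)
    thus ?thesis using *[of c] by (simp add: ennreal_powr_ennreal)
  next
    case top
    let ?I = "\<integral>\<^sup>+t. ennreal (r * t powr (r - 1)) * of_bool (0 < t \<and> ennreal t < y) \<partial>lborel"
    have "ennreal (real n) \<le> ?I" for n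
    proof -
      have "ennreal (real n) = ennreal ((real n powr (1 / r)) powr r)" using r by (simp add: powr_powr)
      also have "\<dots> \<le> ?I" unfolding *[of "real n powr (1 / r)", symmetric, simplified]
        by (intro nn_integral_mono mult_left_mono) (auto simp: top)
      finally show ?thesis .
    qed
    hence "\<not> ?I < of_nat n" for n by (simp add: ennreal_of_nat_eq_real_of_nat not_less)
    hence "?I = \<top>" using ennreal_Ex_less_of_nat[of ?I] less_top[of ?I] by blast
    thus ?thesis using top by (simp add: ennreal_powr_def)
  qed
qed

context preserving_system
begin

text \<open>
  The averages start at \<open>k = 1\<close>, in accordance with \<open>weighted_average\<close>; hence the shift by one step
  that relates them to \<open>orbit_sum\<close>.
\<close>

definition maximal_fun :: "('a \<Rightarrow> real) \<Rightarrow> 'a \<Rightarrow> ennreal" where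
  "maximal_fun h x = (SUP n\<in>{1..}. ennreal ((\<Sum>k=1..n. h ((\<tau> ^^ k) x)) / real n))"

lemma maximal_fun_measurable [measurable]:
  assumes [measurable]: "h \<in> borel_measurable M"
  shows "maximal_fun h \<in> borel_measurable M"
  unfolding maximal_fun_def[abs_def] by measurable

lemma sum_orbit_step: "(\<Sum>k=1..n. h ((\<tau> ^^ k) x)) = orbit_sum (\<lambda>x. h (\<tau> x)) n x"
proof -
  have "(\<Sum>k=1..n. h ((\<tau> ^^ k) x)) = (\<Sum>k<n. h ((\<tau> ^^ Suc k) x))"
    by (rule sum.reindex_bij_witness[where i = Suc and j = "\<lambda>k. k - 1"]) auto
  thus ?thesis by (simp add: orbit_sum_def)
qed

lemma less_maximal_fun_iff:
  assumes "0 \<le> t"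
  shows "ennreal t < maximal_fun h x \<longleftrightarrow> (\<exists>n\<ge>1. t * real n < (\<Sum>k=1..n. h ((\<tau> ^^ k) x)))"
proof -
  have "ennreal t < ennreal (s / real n) \<longleftrightarrow> t * real n < s" if "n \<ge> 1" for n s
    using assms that by (subst ennreal_less_iff) (auto simp: field_simps)
  thus ?thesis unfolding maximal_fun_def less_SUP_iff by auto
qed

text \<open>
  The maximal ergodic theorem for \<open>h \<circ> \<tau> - t\<close>, whose orbit sums are positive at some time exactly
  where the maximal function exceeds \<open>t\<close>.
\<close>

lemma weak_maximal_inequality:
  assumes [measurable]: "h \<in> borel_measurable M" and nn: "\<And>x. 0 \<le> h x" and t: "0 < t"
  shows "ennreal t * emeasure M {x \<in> space M. ennreal t < maximal_fun h x} \<le> (\<integral>\<^sup>+x. h x \<partial>M)"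
proof (cases "(\<integral>\<^sup>+x. h x \<partial>M) = \<infinity>")
  case False
  hence h: "integrable M h" using nn by (intro integrableI_nonneg) (auto simp: less_top)
  note hs = integrable_step[OF h]
  define f where "f x = h (\<tau> x) - t" for x
  have f: "integrable M f" unfolding f_def using hs by simp
  let ?E = "{x \<in> space M. ennreal t < maximal_fun h x}"
  have E: "?E \<in> sets M" by measurable
  have "{x \<in> space M. \<exists>n. 0 < orbit_sum f n x} = ?E"
  proof -
    have "orbit_sum f n x = (\<Sum>k=1..n. h ((\<tau> ^^ k) x)) - t * real n" for n x
      unfolding sum_orbit_step by (simp add: orbit_sum_def f_def sum_subtractf)
    moreover have "(\<exists>n. t * real n < u n) \<longleftrightarrow> (\<exists>n\<ge>1. t * real n < u n)" if "u 0 = 0" for u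
      using that by (metis less_irrefl mult_zero_right of_nat_0 One_nat_def Suc_leI neq0_conv)
    ultimately show ?thesis using t by (simp add: less_maximal_fun_iff)
  qed
  hence "0 \<le> (\<integral>x. f x * indicator ?E x \<partial>M)" using maximal_ergodic[OF f] by simp
  also have "\<dots> = (\<integral>x. h (\<tau> x) * indicator ?E x - t * indicator ?E x \<partial>M)"
    by (simp add: f_def left_diff_distrib)
  also have "\<dots> = (\<integral>x. h (\<tau> x) * indicator ?E x \<partial>M) - (\<integral>x. t * indicator ?E x \<partial>M)"
  proof (rule Bochner_Integration.integral_diff)
    show "integrable M (\<lambda>x. h (\<tau> x) * indicator ?E x)"
      using integrable_mult_indicator[OF E hs(1)] by (simp add: mult.commute)
    show "integrable M (\<lambda>x. t * indicator ?E x)"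
      using E by (intro integrable_mult_right) (simp add: less_top[symmetric])
  qed
  also have "(\<integral>x. t * indicator ?E x \<partial>M) = t * prob ?E"
    using E by (simp add: Int_absorb1 Collect_restrict)
  also have "(\<integral>x. h (\<tau> x) * indicator ?E x \<partial>M) \<le> (\<integral>x. h (\<tau> x) \<partial>M)"
    using integrable_mult_indicator[OF E hs(1)] hs(1) nn
    by (intro integral_mono) (auto simp: mult.commute indicator_def)
  finally have "t * prob ?E \<le> (\<integral>x. h x \<partial>M)" using hs(2) by simp
  hence "ennreal (t * prob ?E) \<le> ennreal (\<integral>x. h x \<partial>M)" by (rule ennreal_leI)
  thus ?thesis using t nn h by (simp add: ennreal_mult emeasure_eq_measure nn_integral_eq_integral)
qed simp

text \<open>
  Values of \<open>h\<close> up to \<open>t / 2\<close> add at most \<open>t / 2\<close> to each average, so the averages of the part of \<open>h\<close>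
  above \<open>t / 2\<close> must make up for the other half. This localization is what the integration over
  \<open>t\<close> needs in order to converge.
\<close>

lemma weak_maximal_inequality_truncated:
  assumes [measurable]: "h \<in> borel_measurable M" and nn: "\<And>x. 0 \<le> h x" and t: "0 < t"
  shows "emeasure M {x \<in> space M. ennreal t < maximal_fun h x}
      \<le> ennreal (2 / t) * (\<integral>\<^sup>+x. ennreal (h x) * of_bool (t < 2 * h x) \<partial>M)"
proof -
  define h' where "h' x = (if t < 2 * h x then h x else 0)" for x
  have [measurable]: "h' \<in> borel_measurable M" unfolding h'_def[abs_def] by measurable
  have "ennreal (t / 2) < maximal_fun h' x" if x: "ennreal t < maximal_fun h x" for x
  proof -
    obtain n where n: "n \<ge> 1" "t * real n < (\<Sum>k=1..n. h ((\<tau> ^^ k) x))"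
      using x t by (auto simp: less_maximal_fun_iff)
    have "(\<Sum>k=1..n. h ((\<tau> ^^ k) x)) \<le> (\<Sum>k=1..n. t / 2 + h' ((\<tau> ^^ k) x))"
      using t by (intro sum_mono) (auto simp: h'_def)
    also have "\<dots> = t / 2 * real n + (\<Sum>k=1..n. h' ((\<tau> ^^ k) x))" by (simp add: sum.distrib)
    finally have "t / 2 * real n < (\<Sum>k=1..n. h' ((\<tau> ^^ k) x))" using n(2) by simp
    thus ?thesis using n t by (auto simp: less_maximal_fun_iff)
  qed
  hence "emeasure M {x \<in> space M. ennreal t < maximal_fun h x}
      \<le> emeasure M {x \<in> space M. ennreal (t / 2) < maximal_fun h' x}"
    by (intro emeasure_mono) auto
  also have "\<dots> = ennreal (2 / t) * (ennreal (t / 2) * emeasure M {x \<in> space M. ennreal (t / 2) < maximal_fun h' x})"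
    using t by (simp add: mult.assoc[symmetric] ennreal_mult[symmetric])
  also have "\<dots> \<le> ennreal (2 / t) * (\<integral>\<^sup>+x. h' x \<partial>M)"
    using weak_maximal_inequality[of h' "t / 2"] nn t by (intro mult_left_mono) (auto simp: h'_def)
  also have "(\<integral>\<^sup>+x. h' x \<partial>M) = (\<integral>\<^sup>+x. ennreal (h x) * of_bool (t < 2 * h x) \<partial>M)"
    by (intro nn_integral_cong) (auto simp: h'_def)
  finally show ?thesis .
qed

text \<open>
  Marcinkiewicz interpolation between the weak inequality and the trivial bound for bounded
  functions: write the \<open>r\<close>-th power as an integral over levels \<open>t\<close>, insert the truncated weak
  inequality and exchange the integrals. The inner integral of \<open>t powr (r - 2)\<close> over \<open>0 < t < 2 h x\<close>
  is finite because \<open>r > 1\<close>.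
\<close>

theorem dominated_ergodic:
  assumes [measurable]: "h \<in> borel_measurable M" and nn: "\<And>x. 0 \<le> h x" and r: "1 < r"
  shows "(\<integral>\<^sup>+x. ennreal_powr (maximal_fun h x) r \<partial>M)
      \<le> ennreal (2 powr r * r / (r - 1)) * (\<integral>\<^sup>+x. ennreal (h x powr r) \<partial>M)"
proof -
  interpret P: pair_sigma_finite M lborel ..
  have "(\<integral>\<^sup>+x. ennreal_powr (maximal_fun h x) r \<partial>M)
     = (\<integral>\<^sup>+x. \<integral>\<^sup>+t. ennreal (r * t powr (r - 1)) * of_bool (0 < t \<and> ennreal t < maximal_fun h x) \<partial>lborel \<partial>M)"
    using r by (intro nn_integral_cong ennreal_powr_layer_cake) simp
  also have "\<dots> = (\<integral>\<^sup>+t. \<integral>\<^sup>+x. ennreal (r * t powr (r - 1)) * of_bool (0 < t \<and> ennreal t < maximal_fun h x) \<partial>M \<partial>lborel)"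
    by (rule P.Fubini'[symmetric]) measurable
  also have "\<dots> \<le> (\<integral>\<^sup>+t. \<integral>\<^sup>+x. ennreal (2 * r) * ennreal (h x) * (ennreal (t powr (r - 2)) * of_bool (0 < t \<and> t < 2 * h x)) \<partial>M \<partial>lborel)"
  proof (rule nn_integral_mono)
    fix t :: real
    show "(\<integral>\<^sup>+x. ennreal (r * t powr (r - 1)) * of_bool (0 < t \<and> ennreal t < maximal_fun h x) \<partial>M)
      \<le> (\<integral>\<^sup>+x. ennreal (2 * r) * ennreal (h x) * (ennreal (t powr (r - 2)) * of_bool (0 < t \<and> t < 2 * h x)) \<partial>M)"
    proof (cases "0 < t")
      case True
      have "(\<integral>\<^sup>+x. ennreal (r * t powr (r - 1)) * of_bool (0 < t \<and> ennreal t < maximal_fun h x) \<partial>M)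
        = (\<integral>\<^sup>+x. ennreal (r * t powr (r - 1)) * indicator {x \<in> space M. ennreal t < maximal_fun h x} x \<partial>M)"
        using True by (intro nn_integral_cong) (auto simp: indicator_def)
      also have "\<dots> = ennreal (r * t powr (r - 1)) * emeasure M {x \<in> space M. ennreal t < maximal_fun h x}"
        by (rule nn_integral_cmult_indicator) measurable
      also have "\<dots> \<le> ennreal (r * t powr (r - 1)) * (ennreal (2 / t) * (\<integral>\<^sup>+x. ennreal (h x) * of_bool (t < 2 * h x) \<partial>M))"
        by (intro mult_left_mono weak_maximal_inequality_truncated nn True) auto
      also have "\<dots> = ennreal (2 * r * t powr (r - 2)) * (\<integral>\<^sup>+x. ennreal (h x) * of_bool (t < 2 * h x) \<partial>M)"
      proof -
        have "r * t powr (r - 1) * (2 / t) = 2 * r * t powr (r - 2)"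
          using True powr_diff[of t "r - 1" 1] by simp
        thus ?thesis using True r by (simp add: mult.assoc[symmetric] ennreal_mult[symmetric])
      qed
      also have "\<dots> = (\<integral>\<^sup>+x. ennreal (2 * r * t powr (r - 2)) * (ennreal (h x) * of_bool (t < 2 * h x)) \<partial>M)"
        by (rule nn_integral_cmult[symmetric]) measurable
      also have "\<dots> = (\<integral>\<^sup>+x. ennreal (2 * r) * ennreal (h x) * (ennreal (t powr (r - 2)) * of_bool (0 < t \<and> t < 2 * h x)) \<partial>M)"
        using True r nn by (intro nn_integral_cong) (auto simp: ennreal_mult[symmetric] mult_ac)
      finally show ?thesis .
    qed simp
  qed
  also have "\<dots> = (\<integral>\<^sup>+x. \<integral>\<^sup>+t. ennreal (2 * r) * ennreal (h x) * (ennreal (t powr (r - 2)) * of_bool (0 < t \<and> t < 2 * h x)) \<partial>lborel \<partial>M)"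
    by (rule P.Fubini') measurable
  also have "\<dots> = (\<integral>\<^sup>+x. ennreal (2 powr r * r / (r - 1)) * ennreal (h x powr r) \<partial>M)"
  proof (rule nn_integral_cong)
    fix x
    have "(\<integral>\<^sup>+t. ennreal (2 * r) * ennreal (h x) * (ennreal (t powr (r - 2)) * of_bool (0 < t \<and> t < 2 * h x)) \<partial>lborel)
      = ennreal (2 * r) * ennreal (h x) * ennreal ((2 * h x) powr (r - 2 + 1) / (r - 2 + 1))"
      using nn_integral_powr_Ioo[of "r - 2" "2 * h x"] r nn[of x] by (subst nn_integral_cmult) auto
    also have "\<dots> = ennreal (2 * r * h x * ((2 * h x) powr (r - 1) / (r - 1)))"
      using r nn[of x] by (simp add: ennreal_mult[symmetric])
    also have "2 * r * h x * ((2 * h x) powr (r - 1) / (r - 1)) = 2 powr r * r / (r - 1) * h x powr r"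
    proof (cases "h x = 0")
      case False
      hence "h x > 0" using nn[of x] by simp
      have "(2 * h x) powr (r - 1) = (2 * h x) powr r / (2 * h x)"
        using \<open>h x > 0\<close> by (simp add: powr_diff)
      thus ?thesis using \<open>h x > 0\<close> by (simp add: powr_mult)
    qed (use r in simp)
    finally show "(\<integral>\<^sup>+t. ennreal (2 * r) * ennreal (h x) * (ennreal (t powr (r - 2)) * of_bool (0 < t \<and> t < 2 * h x)) \<partial>lborel)
      = ennreal (2 powr r * r / (r - 1)) * ennreal (h x powr r)"
      using r by (simp add: ennreal_mult[symmetric])
  qed
  also have "\<dots> = ennreal (2 powr r * r / (r - 1)) * (\<integral>\<^sup>+x. ennreal (h x powr r) \<partial>M)"
    by (rule nn_integral_cmult) measurable
  finally show ?thesis .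
qed

end

section \<open>Ergodic theorems with nearly constant weights\<close>

lemma ennreal_powr_powr: "ennreal_powr (ennreal_powr x a) b = ennreal_powr x (a * b)"
  by (simp add: ennreal_powr_def powr_powr)

lemma Lp_norm_less_top_iff:
  assumes "p > 0"
  shows "Lp_norm M p h < \<top> \<longleftrightarrow> (\<integral>\<^sup>+x. ennreal_powr (h x) p \<partial>M) < \<top>"
  by (simp add: Lp_norm_def ennreal_powr_def less_top[symmetric])

lemma norm_weighted_sum_le:
  fixes f :: "nat \<Rightarrow> complex"
  assumes "n \<ge> 1"
  shows "norm (\<Sum>k=1..n. w k *\<^sub>R f k) \<le> sqrt (real n * (\<Sum>k=1..n. (w k)\<^sup>2)) * sqrt ((\<Sum>k=1..n. (norm (f k))\<^sup>2) / real n)"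
proof -
  have "norm (\<Sum>k=1..n. w k *\<^sub>R f k) \<le> (\<Sum>k=1..n. \<bar>w k\<bar> * norm (f k))"
    using norm_sum[of "\<lambda>k. w k *\<^sub>R f k" "{1..n}"] by simp
  also have "\<dots> \<le> sqrt ((\<Sum>k=1..n. (w k)\<^sup>2) * (\<Sum>k=1..n. (norm (f k))\<^sup>2))"
    using Cauchy_Schwarz_ineq_sum[of "\<lambda>k. \<bar>w k\<bar>" "\<lambda>k. norm (f k)" "{1..n}"]
    by (intro real_le_rsqrt) simp
  also have "(\<Sum>k=1..n. (w k)\<^sup>2) * (\<Sum>k=1..n. (norm (f k))\<^sup>2)
      = (real n * (\<Sum>k=1..n. (w k)\<^sup>2)) * ((\<Sum>k=1..n. (norm (f k))\<^sup>2) / real n)"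
    using assms by simp
  finally show ?thesis by (simp only: real_sqrt_mult)
qed

context preserving_system
begin

text \<open>
  The second moment of the weights is bounded by \<open>weight_sum w n\<close>, so Cauchy-Schwarz leaves only the
  plain average of \<open>\<bar>f\<bar>\<^sup>2\<close>, whatever \<open>n\<close> is.
\<close>

lemma norm_weighted_average_le:
  assumes K: "K > 0" "\<And>n. sqrt (real n * (\<Sum>k=1..n. (w k)\<^sup>2)) \<le> K * weight_sum w n"
  shows "(SUP n\<in>{1..}. ennreal (norm (weighted_average w \<tau> f n x)))
     \<le> ennreal K * ennreal_powr (maximal_fun (\<lambda>x. (norm (f x))\<^sup>2) x) (1/2)"
proof (rule SUP_least)
  fix n :: nat assume "n \<in> {1..}"
  hence n: "n \<ge> 1" by simp
  let ?avg = "(\<Sum>k=1..n. (norm (f ((\<tau> ^^ k) x)))\<^sup>2) / real n"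
  have avg: "0 \<le> ?avg" by (simp add: sum_nonneg)
  have W: "0 \<le> weight_sum w n" by (simp add: weight_sum_def sum_nonneg)
  have "norm (weighted_average w \<tau> f n x) \<le> K * sqrt ?avg"
  proof (cases "weight_sum w n = 0")
    case True
    thus ?thesis using K avg by (simp add: weighted_average_def)
  next
    case False
    hence W: "weight_sum w n > 0" using W by simp
    have "norm (\<Sum>k=1..n. w k *\<^sub>R f ((\<tau> ^^ k) x)) \<le> K * weight_sum w n * sqrt ?avg"
      using norm_weighted_sum_le[OF n, of w "\<lambda>k. f ((\<tau> ^^ k) x)"] mult_right_mono[OF K(2)[of n], of "sqrt ?avg"] avg
      by (meson order.trans real_sqrt_ge_zero)
    thus ?thesis using W by (simp add: weighted_average_def field_simps)
  qed
  hence "ennreal (norm (weighted_average w \<tau> f n x)) \<le> ennreal (K * sqrt ?avg)" by (rule ennreal_leI)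
  also have "\<dots> = ennreal K * ennreal_powr (ennreal ?avg) (1/2)"
    using K avg by (simp add: ennreal_mult ennreal_powr_ennreal powr_half_sqrt)
  also have "\<dots> \<le> ennreal K * ennreal_powr (maximal_fun (\<lambda>x. (norm (f x))\<^sup>2) x) (1/2)"
    unfolding maximal_fun_def using n by (intro mult_left_mono ennreal_powr_mono SUP_upper) auto
  finally show "ennreal (norm (weighted_average w \<tau> f n x)) \<le> ennreal K * ennreal_powr (maximal_fun (\<lambda>x. (norm (f x))\<^sup>2) x) (1/2)" .
qed

lemma weighted_dominated:
  assumes K: "K > 0" "\<And>n. sqrt (real n * (\<Sum>k=1..n. (w k)\<^sup>2)) \<le> K * weight_sum w n"
    and p: "p > 2" and f: "f \<in> borel_measurable M"
  defines "C \<equiv> K powr p * (2 powr (p/2) * (p/2) / (p/2 - 1))"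
  shows "Lp_norm M p (\<lambda>x. SUP n\<in>{1..}. ennreal (norm (weighted_average w \<tau> f n x)))
     \<le> ennreal (C powr (1 / p)) * Lp_norm M p (\<lambda>x. ennreal (norm (f x)))"
proof -
  note [measurable] = f
  let ?F = "\<lambda>x. (norm (f x))\<^sup>2"
  let ?C0 = "2 powr (p/2) * (p/2) / (p/2 - 1)"
  have C: "C > 0" and C0: "?C0 > 0" using K p by (auto simp: C_def)
  have "(\<integral>\<^sup>+x. ennreal_powr (SUP n\<in>{1..}. ennreal (norm (weighted_average w \<tau> f n x))) p \<partial>M)
    \<le> (\<integral>\<^sup>+x. ennreal_powr (ennreal K * ennreal_powr (maximal_fun ?F x) (1/2)) p \<partial>M)"
    using p by (intro nn_integral_mono ennreal_powr_mono norm_weighted_average_le K) auto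
  also have "\<dots> = (\<integral>\<^sup>+x. ennreal (K powr p) * ennreal_powr (maximal_fun ?F x) (p/2) \<partial>M)"
    by (simp add: ennreal_powr_mult K ennreal_powr_powr)
  also have "\<dots> = ennreal (K powr p) * (\<integral>\<^sup>+x. ennreal_powr (maximal_fun ?F x) (p/2) \<partial>M)"
    by (rule nn_integral_cmult) measurable
  also have "\<dots> \<le> ennreal (K powr p) * (ennreal ?C0 * (\<integral>\<^sup>+x. ennreal (?F x powr (p/2)) \<partial>M))"
    using p by (intro mult_left_mono dominated_ergodic) auto
  also have "\<dots> = ennreal C * (\<integral>\<^sup>+x. ennreal_powr (ennreal (norm (f x))) p \<partial>M)"
  proof -
    have "?F x powr (p/2) = norm (f x) powr p" for x
    proof (cases "f x = 0")
      case False
      hence sq: "?F x = norm (f x) powr 2" by simp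
      show ?thesis unfolding sq powr_powr by simp
    qed (use p in simp)
    hence "(\<integral>\<^sup>+x. ennreal (?F x powr (p/2)) \<partial>M) = (\<integral>\<^sup>+x. ennreal_powr (ennreal (norm (f x))) p \<partial>M)"
      by (simp add: ennreal_powr_ennreal)
    moreover have "ennreal C = ennreal (K powr p) * ennreal ?C0"
      unfolding C_def using C0 by (intro ennreal_mult) auto
    ultimately show ?thesis by (simp only: mult.assoc)
  qed
  finally have "Lp_norm M p (\<lambda>x. SUP n\<in>{1..}. ennreal (norm (weighted_average w \<tau> f n x)))
     \<le> ennreal_powr (ennreal C * (\<integral>\<^sup>+x. ennreal_powr (ennreal (norm (f x))) p \<partial>M)) (1/p)"
    unfolding Lp_norm_def using p by (intro ennreal_powr_mono) auto
  thus ?thesis unfolding Lp_norm_def by (simp add: ennreal_powr_mult C)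
qed

lemma Lp_integrable_square:
  assumes f: "f \<in> Lp M p" and p: "p > 2"
  shows "integrable M (\<lambda>x. (norm (f x))\<^sup>2)" "integrable M f"
proof -
  have [measurable]: "f \<in> borel_measurable M" using f by (simp add: Lp_def)
  have "(\<integral>\<^sup>+x. ennreal (norm (f x) powr p) \<partial>M) < \<top>"
    using f p by (simp add: Lp_def Lp_norm_less_top_iff ennreal_powr_ennreal)
  hence fp: "integrable M (\<lambda>x. norm (f x) powr p)" by (intro integrableI_nonneg) auto
  have bound: "t\<^sup>2 \<le> 1 + t powr p" if "t \<ge> 0" for t :: real
  proof (cases "t \<le> 1")
    case True
    have "t\<^sup>2 \<le> 1" using that True by (simp add: power_le_one)
    thus ?thesis by (simp add: add_increasing2)
  next
    case False
    hence "t powr 2 \<le> t powr p" using p by (intro powr_mono) auto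
    thus ?thesis using False by (simp add: powr_realpow)
  qed
  show sq: "integrable M (\<lambda>x. (norm (f x))\<^sup>2)"
    by (rule Bochner_Integration.integrable_bound[of _ "\<lambda>x. 1 + norm (f x) powr p"]) (use fp bound in auto)
  have bound1: "t \<le> 1 + t\<^sup>2" if "t \<ge> 0" for t :: real
    using sum_squares_bound[of t 1] that by simp
  show "integrable M f"
    by (rule Bochner_Integration.integrable_bound[of _ "\<lambda>x. 1 + (norm (f x))\<^sup>2"]) (use sq bound1 in auto)
qed

lemma birkhoff_ergodic_shifted:
  fixes h :: "'a \<Rightarrow> real"
  assumes "integrable M h"
  shows "AE x in M. convergent (\<lambda>n. (\<Sum>k=1..n. h ((\<tau> ^^ k) x)) / real n)"
  using birkhoff_ergodic_real[OF integrable_step(1)[OF assms]] unfolding sum_orbit_step .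

lemma birkhoff_ergodic_complex:
  fixes f :: "'a \<Rightarrow> complex"
  assumes f: "integrable M f"
  shows "AE x in M. convergent (\<lambda>n. (\<Sum>k=1..n. f ((\<tau> ^^ k) x)) /\<^sub>R real n)"
proof -
  have "AE x in M. convergent (\<lambda>n. (\<Sum>k=1..n. Re (f ((\<tau> ^^ k) x))) / real n)"
    by (rule birkhoff_ergodic_shifted) (use f in simp)
  moreover have "AE x in M. convergent (\<lambda>n. (\<Sum>k=1..n. Im (f ((\<tau> ^^ k) x))) / real n)"
    by (rule birkhoff_ergodic_shifted) (use f in simp)
  ultimately show ?thesis
  proof eventually_elim
    case (elim x)
    then obtain a b where ab: "(\<lambda>n. (\<Sum>k=1..n. Re (f ((\<tau> ^^ k) x))) / real n) \<longlonglongrightarrow> a"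
      "(\<lambda>n. (\<Sum>k=1..n. Im (f ((\<tau> ^^ k) x))) / real n) \<longlonglongrightarrow> b"
      unfolding convergent_def by blast
    have "(\<lambda>n. (\<Sum>k=1..n. f ((\<tau> ^^ k) x)) /\<^sub>R real n) \<longlonglongrightarrow> Complex a b"
      unfolding tendsto_complex_iff using ab by (simp add: divide_inverse mult.commute)
    thus ?case by (rule convergentI)
  qed
qed

text \<open>
  Replacing the weights up to time \<open>n\<close> by the constant \<open>c n\<close> leaves the ordinary ergodic average times a
  convergent factor. The error is at most \<open>deviation w c n / weight_sum w n\<close>, which tends to zero,
  times the square root of the average of \<open>\<bar>f\<bar>\<^sup>2\<close>, which converges.
\<close>

lemma concentrated_weight_pointwise:
  assumes w: "concentrated_weight w c" and f: "f \<in> Lp M p" and p: "p > 2"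
  shows "AE x in M. convergent (\<lambda>n. weighted_average w \<tau> f n x)"
  using birkhoff_ergodic_complex[OF Lp_integrable_square(2)[OF f p]]
    birkhoff_ergodic_shifted[OF Lp_integrable_square(1)[OF f p]]
proof eventually_elim
  case (elim x)
  let ?W = "weight_sum w"
  let ?a = "\<lambda>k. f ((\<tau> ^^ k) x)"
  let ?q = "\<lambda>n. (\<Sum>k=1..n. (norm (?a k))\<^sup>2) / real n"
  obtain L where L: "(\<lambda>n. (\<Sum>k=1..n. ?a k) /\<^sub>R real n) \<longlonglongrightarrow> L"
    using elim(1) unfolding convergent_def by blast
  obtain S where S: "?q \<longlonglongrightarrow> S" using elim(2) unfolding convergent_def by blast
  \<comment> \<open>The decomposition is \<open>w k = c n + (w k - c n)\<close> for each \<open>n\<close>.\<close>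
  obtain s where s: "(\<lambda>n. real n * c n / ?W n) \<longlonglongrightarrow> s"
    using w unfolding concentrated_weight_def convergent_def by blast
  have main: "(\<lambda>n. (real n * c n / ?W n) *\<^sub>R ((\<Sum>k=1..n. ?a k) /\<^sub>R real n)) \<longlonglongrightarrow> s *\<^sub>R L"
    by (intro tendsto_scaleR s L)
  have "(\<lambda>n. deviation w c n / ?W n * sqrt (?q n)) \<longlonglongrightarrow> 0 * sqrt S"
    using w unfolding concentrated_weight_def by (intro tendsto_mult tendsto_real_sqrt S) auto
  hence bound: "(\<lambda>n. deviation w c n / ?W n * sqrt (?q n)) \<longlonglongrightarrow> 0" by simp
  have rem: "(\<lambda>n. (\<Sum>k=1..n. (w k - c n) *\<^sub>R ?a k) /\<^sub>R ?W n) \<longlonglongrightarrow> 0"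
  proof (rule Lim_null_comparison[OF _ bound])
    show "\<forall>\<^sub>F n in sequentially. norm ((\<Sum>k=1..n. (w k - c n) *\<^sub>R ?a k) /\<^sub>R ?W n) \<le> deviation w c n / ?W n * sqrt (?q n)"
      using eventually_ge_at_top[of 1]
    proof eventually_elim
      case (elim n)
      have W: "?W n \<ge> 0" by (simp add: weight_sum_def sum_nonneg)
      have "norm (\<Sum>k=1..n. (w k - c n) *\<^sub>R ?a k) \<le> deviation w c n * sqrt (?q n)"
        unfolding deviation_def by (rule norm_weighted_sum_le[OF elim])
      hence "norm (\<Sum>k=1..n. (w k - c n) *\<^sub>R ?a k) / ?W n \<le> deviation w c n * sqrt (?q n) / ?W n"
        using W by (rule divide_right_mono)
      thus ?case using W by (simp add: divide_inverse mult_ac)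
    qed
  qed
  have "(\<lambda>n. (real n * c n / ?W n) *\<^sub>R ((\<Sum>k=1..n. ?a k) /\<^sub>R real n)
     + (\<Sum>k=1..n. (w k - c n) *\<^sub>R ?a k) /\<^sub>R ?W n) \<longlonglongrightarrow> s *\<^sub>R L + 0"
    by (intro tendsto_add main rem)
  moreover have "\<forall>\<^sub>F n in sequentially. (real n * c n / ?W n) *\<^sub>R ((\<Sum>k=1..n. ?a k) /\<^sub>R real n)
     + (\<Sum>k=1..n. (w k - c n) *\<^sub>R ?a k) /\<^sub>R ?W n = weighted_average w \<tau> f n x"
    using eventually_ge_at_top[of 1]
  proof eventually_elim
    case (elim n)
    have eq1: "(real n * c n / ?W n) *\<^sub>R ((\<Sum>k=1..n. ?a k) /\<^sub>R real n) = (\<Sum>k=1..n. c n *\<^sub>R ?a k) /\<^sub>R ?W n"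
      using elim by (simp add: scaleR_sum_right[symmetric] divide_inverse mult_ac)
    have eq2: "(\<Sum>k=1..n. c n *\<^sub>R ?a k) + (\<Sum>k=1..n. (w k - c n) *\<^sub>R ?a k) = (\<Sum>k=1..n. w k *\<^sub>R ?a k)"
      by (simp add: sum.distrib[symmetric] scaleR_left_diff_distrib)
    show ?case unfolding weighted_average_def eq1 scaleR_right_distrib[symmetric] eq2 ..
  qed
  ultimately have "(\<lambda>n. weighted_average w \<tau> f n x) \<longlonglongrightarrow> s *\<^sub>R L + 0" by (rule Lim_transform_eventually)
  thus ?case by (rule convergentI)
qed

end

lemma Lp_norm_distr:
  assumes "\<Phi> \<in> M \<rightarrow>\<^sub>M N" "h \<in> borel_measurable N"
  shows "Lp_norm (distr M N \<Phi>) p h = Lp_norm M p (\<lambda>x. h (\<Phi> x))"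
  unfolding Lp_norm_def using assms by (subst nn_integral_distr) auto

text \<open>
  The map \<open>\<Phi>\<close> sends a point to the values of \<open>f\<close> along its orbit. It intertwines \<open>\<tau>\<close> with the shift \<open>\<sigma>\<close>, and
  \<open>f\<close> becomes the zeroth coordinate \<open>\<pi>\<close>, so weighted averages and their norms are the same for the
  law of \<open>\<Phi>\<close> on the sequence space.
\<close>

lemma dominated_bound_transfer:
  assumes bound: "dominated_bound TYPE(nat \<Rightarrow> complex) w p C"
  shows "dominated_bound TYPE('a) w p C"
  unfolding dominated_bound_def
proof (intro allI impI ballI)
  fix M :: "'a measure" and \<tau> f
  assume sys: "dynamical_system M \<tau>" and f: "f \<in> Lp M p"
  interpret preserving_system M \<tau> by unfold_locales (rule sys)
  have [measurable]: "f \<in> borel_measurable M" using f by (simp add: Lp_def)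
  define N :: "(nat \<Rightarrow> complex) measure" where "N = PiM UNIV (\<lambda>_. borel)"
  define \<Phi> where "\<Phi> x = (\<lambda>k. f ((\<tau> ^^ k) x))" for x
  define \<sigma> :: "(nat \<Rightarrow> complex) \<Rightarrow> nat \<Rightarrow> complex" where "\<sigma> u = (\<lambda>k. u (Suc k))" for u
  define \<pi> :: "(nat \<Rightarrow> complex) \<Rightarrow> complex" where "\<pi> u = u 0" for u
  let ?N = "distr M N \<Phi>"
  have \<Phi> [measurable]: "\<Phi> \<in> M \<rightarrow>\<^sub>M N"
    unfolding N_def \<Phi>_def by (rule measurable_PiM_single') (auto simp: space_PiM PiE_UNIV_domain)
  have \<sigma> [measurable]: "\<sigma> \<in> N \<rightarrow>\<^sub>M N"
    unfolding N_def \<sigma>_def by (rule measurable_PiM_single') (auto simp: space_PiM PiE_UNIV_domain)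
  have \<pi> [measurable]: "\<pi> \<in> borel_measurable N" unfolding N_def \<pi>_def by measurable
  have shift: "\<sigma> (\<Phi> x) = \<Phi> (\<tau> x)" for x by (simp add: \<sigma>_def \<Phi>_def funpow_swap1)
  have iter: "\<pi> ((\<sigma> ^^ k) (\<Phi> x)) = f ((\<tau> ^^ k) x)" for k x
  proof -
    have "(\<sigma> ^^ k) (\<Phi> x) = \<Phi> ((\<tau> ^^ k) x)" by (induction k) (simp_all add: shift)
    thus ?thesis by (simp add: \<pi>_def \<Phi>_def)
  qed
  have "distr ?N N \<sigma> = distr M N (\<lambda>x. \<Phi> (\<tau> x))"
    by (subst distr_distr) (auto simp: o_def shift)
  also have "\<dots> = distr (distr M M \<tau>) N \<Phi>" by (subst distr_distr) (auto simp: o_def)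
  finally have "distr ?N N \<sigma> = ?N" by (simp only: distr_step)
  moreover have "distr ?N ?N \<sigma> = distr ?N N \<sigma>" by (rule distr_cong) auto
  ultimately have sysN: "dynamical_system ?N \<sigma>"
    unfolding dynamical_system_def using prob_space_distr[OF \<Phi>] \<sigma> by simp
  have avg: "weighted_average w \<sigma> \<pi> n (\<Phi> x) = weighted_average w \<tau> f n x" for n x
    unfolding weighted_average_def iter ..
  have norm_\<pi>: "Lp_norm ?N p (\<lambda>u. ennreal (norm (\<pi> u))) = Lp_norm M p (\<lambda>x. ennreal (norm (f x)))"
    using iter[of 0] by (subst Lp_norm_distr) auto
  have "\<pi> \<in> Lp ?N p" using f norm_\<pi> by (simp add: Lp_def)
  hence "Lp_norm ?N p (\<lambda>u. SUP n\<in>{1..}. ennreal (norm (weighted_average w \<sigma> \<pi> n u)))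
      \<le> ennreal C * Lp_norm ?N p (\<lambda>u. ennreal (norm (\<pi> u)))"
    using bound sysN unfolding dominated_bound_def by blast
  moreover have meas: "(\<lambda>u. SUP n\<in>{1..}. ennreal (norm (weighted_average w \<sigma> \<pi> n u))) \<in> borel_measurable N"
    unfolding weighted_average_def by measurable
  have "Lp_norm ?N p (\<lambda>u. SUP n\<in>{1..}. ennreal (norm (weighted_average w \<sigma> \<pi> n u)))
      = Lp_norm M p (\<lambda>x. SUP n\<in>{1..}. ennreal (norm (weighted_average w \<tau> f n x)))"
    by (simp only: Lp_norm_distr[OF \<Phi> meas] avg)
  ultimately show "Lp_norm M p (\<lambda>x. SUP n\<in>{1..}. ennreal (norm (weighted_average w \<tau> f n x)))
      \<le> ennreal C * Lp_norm M p (\<lambda>x. ennreal (norm (f x)))"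
    by (simp only: norm_\<pi>)
qed

theorem concentrated_weight_good:
  assumes w: "concentrated_weight w c" and p: "p > 2"
  shows "good_weight_dominated TYPE('a) w p" "good_weight_pointwise TYPE('a) w p"
proof -
  have adm: "admissible_weight w" using w by (simp add: concentrated_weight_def)
  obtain K where K: "K > 0" "\<And>n. sqrt (real n * (\<Sum>k=1..n. (w k)\<^sup>2)) \<le> K * weight_sum w n"
    using concentrated_weight_second_moment[OF w] by blast
  let ?C = "(K powr p * (2 powr (p/2) * (p/2) / (p/2 - 1))) powr (1/p)"
  have "dominated_bound TYPE(nat \<Rightarrow> complex) w p ?C"
    unfolding dominated_bound_def
  proof (intro allI impI ballI)
    fix M :: "(nat \<Rightarrow> complex) measure" and \<tau> f
    assume sys: "dynamical_system M \<tau>" and f: "f \<in> Lp M p"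
    interpret preserving_system M \<tau> by unfold_locales (rule sys)
    show "Lp_norm M p (\<lambda>x. SUP n\<in>{1..}. ennreal (norm (weighted_average w \<tau> f n x)))
      \<le> ennreal ?C * Lp_norm M p (\<lambda>x. ennreal (norm (f x)))"
      using f by (intro weighted_dominated K p) (simp add: Lp_def)
  qed
  moreover have "?C > 0" using K(1) p by simp
  ultimately show "good_weight_dominated TYPE('a) w p"
    unfolding good_weight_dominated_def using adm dominated_bound_transfer by blast
  show "good_weight_pointwise TYPE('a) w p"
    unfolding good_weight_pointwise_def
  proof (intro conjI adm allI impI ballI)
    fix M :: "'a measure" and \<tau> f
    assume sys: "dynamical_system M \<tau>" and f: "f \<in> Lp M p"
    interpret preserving_system M \<tau> by unfold_locales (rule sys)
    show "AE x in M. convergent (\<lambda>n. weighted_average w \<tau> f n x)"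
      by (rule concentrated_weight_pointwise[OF w f p])
  qed
qed

theorem theorem2p9:
  fixes g :: "nat \<Rightarrow> real" and p :: real
  assumes "additive_arith g"
    and "\<exists>n\<ge>1. g n \<noteq> 0"
    and "(\<lambda>n::nat. sqrt (\<Sum>m | primepow m \<and> m \<le> n. (g m)\<^sup>2 / real m))
           \<in> o(\<lambda>n. \<Sum>m | primepow m \<and> m \<le> n. g m / real m)"
    and "p > 2"
  shows "good_weight_dominated TYPE('a) g p \<and> good_weight_pointwise TYPE('a) g p"
proof -
  have "(\<lambda>n. sqrt (pp_var g n)) \<in> o(pp_mean g)"
    using assms(3) unfolding pp_var_def pp_mean_def[abs_def] .
  hence "concentrated_weight g (pp_mean g)" by (rule additive_concentrated[OF assms(1,2)])
  thus ?thesis using concentrated_weight_good \<open>p > 2\<close> by blast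
qed

end
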